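(* Let $E\le\mathrm{Homeo}_+(\mathbb{R})$ be robust, FG-filtered, and tame at $\infty$. If $E$ embeds (as an abstract group) in Thompson's group $V$, then every finitely generated subgroup of the group of germs of $E$ at $\infty$ is cyclic.
   Context: Thompson's group $V$ is the group of all homeomorphisms $h$ of $\mathfrak{C}=\{0,1\}^{\mathbb{N}}$ (acting on the right) such that for every $\kappa\in\mathfrak{C}$ there exist a finite prefix $w$ of $\kappa$ and a finite string $u$ over $\{0,1\}$ with $(w\kappa')h=u\kappa'$ for all $\kappa'\in\mathfrak{C}$. $\mathrm{Homeo}_+(\mathbb{R})$ is the group of orientation-preserving homeomorphisms of $\mathbb{R}$. The support $\mathrm{Supp}(f)$ is the set of points not fixed by $f$. For $E\le\mathrm{Homeo}_+(\mathbb{R})$ and $a<b$ in $\mathbb{R}$, let $E[a,b]=\{f\in E\mid \mathrm{Supp}(f)\subseteq[a,b]\}$ and let $E[a,b]'$ be its commutator subgroup; $E'$ is the commutator subgroup of $E$. $E$ is locally moving if for all $a<b$ the group $E[a,b]$ has no global fixed points in $(a,b)$. The group of germs of $E$ at $x\in\mathbb{R}$ is the quotient of $\mathrm{Stab}_E(x)$ by the normal subgroup of elements fixing pointwise an open neighborhood of $x$; $E$ has abelian germs if this group is abelian for all $x\in\mathbb{R}$. $E$ is robust if it is locally moving with abelian germs, $E'$ is the union of the $E[a,b]'$ over all $a<b$ in $\mathbb{R}$, and whenever $f\in E'$ has the closure of its support contained in $(a,b)$ we have $f\in E[a,b]'$. $E$ is FG-filtered if for all $a<b$ in $\mathbb{R}$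 the group $E[a,b]'$ is contained in a finitely generated subgroup of $E[\ell,r]'$ for some $\ell<r$ in $\mathbb{R}$ with $\ell<a<b<r$. $E$ is tame at $\infty$ if for every $f\in E$ there exists $a\in\mathbb{R}$ such that the entire ray $(a,\infty)$ is either contained in the fixed point set of $f$ or contained in the support of $f$. The group of germs of $E$ at $\infty$ is the quotient of $E$ by the normal subgroup of all $f\in E$ that fix pointwise some open ray $(a,\infty)$. *)

theory Defs
  imports "HOL-Analysis.Analysis" "HOL-Algebra.Elementary_Groups" "HOL-Library.Omega_Words_Fun"
begin

text \<open>
  All groups of homeomorphisms act on the right, so the product of \<open>f\<close> and \<open>g\<close> is
  ``first \<open>f\<close>, then \<open>g\<close>''.  An orientation-preserving homeomorphism of the real line is a
  strictly increasing one.
\<close>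

definition homeo_plus :: "(real \<Rightarrow> real) monoid" where
  "homeo_plus =
     \<lparr>carrier = {f. (\<exists>g. homeomorphism UNIV UNIV f g) \<and> strict_mono f},
      mult = (\<lambda>f g. g \<circ> f),
      one = id\<rparr>"

text \<open>
  The Cantor space is the type \<open>bool word = nat \<Rightarrow> bool\<close>, whose library topology is the product
  of the discrete topologies, with \<open>False\<close> and \<open>True\<close> in the roles of 0 and 1.  The concatenation
  of a finite string \<open>w\<close> with a sequence \<open>x\<close> is \<open>w \<frown> x\<close>, and \<open>prefix k x\<close> is the prefix of \<open>x\<close>
  of length \<open>k\<close>.
\<close>

definition thompson_V :: "(bool word \<Rightarrow> bool word) monoid" where
  "thompson_V =
     \<lparr>carrier = {h. (\<exists>g. homeomorphism UNIV UNIV h g) \<and>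
                   (\<forall>\<kappa>. \<exists>k u. \<forall>\<kappa>'. h (prefix k \<kappa> \<frown> \<kappa>') = u \<frown> \<kappa>')},
      mult = (\<lambda>f g. g \<circ> f),
      one = id\<rparr>"

definition Supp :: "('a \<Rightarrow> 'a) \<Rightarrow> 'a set" where
  "Supp f = {x. f x \<noteq> x}"

definition supported_in :: "(real \<Rightarrow> real) set \<Rightarrow> real \<Rightarrow> real \<Rightarrow> (real \<Rightarrow> real) set" where
  "supported_in E a b = {f \<in> E. Supp f \<subseteq> {a..b}}"

definition locally_moving :: "(real \<Rightarrow> real) set \<Rightarrow> bool" where
  "locally_moving E \<longleftrightarrow>
     (\<forall>a b. a < b \<longrightarrow> \<not> (\<exists>x\<in>{a<..<b}. \<forall>f\<in>supported_in E a b. f x = x))"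

definition point_stabilizer :: "(real \<Rightarrow> real) set \<Rightarrow> real \<Rightarrow> (real \<Rightarrow> real) set" where
  "point_stabilizer E x = {f \<in> E. f x = x}"

definition trivial_near :: "(real \<Rightarrow> real) set \<Rightarrow> real \<Rightarrow> (real \<Rightarrow> real) set" where
  "trivial_near E x = {f \<in> E. \<exists>U. open U \<and> x \<in> U \<and> (\<forall>y\<in>U. f y = y)}"

definition germs_at :: "(real \<Rightarrow> real) set \<Rightarrow> real \<Rightarrow> (real \<Rightarrow> real) set monoid" where
  "germs_at E x = homeo_plus\<lparr>carrier := point_stabilizer E x\<rparr> Mod trivial_near E x"

definition abelian_germs :: "(real \<Rightarrow> real) set \<Rightarrow> bool" where
  "abelian_germs E \<longleftrightarrow> (\<forall>x. comm_group (germs_at E x))"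

definition robust :: "(real \<Rightarrow> real) set \<Rightarrow> bool" where
  "robust E \<longleftrightarrow>
     locally_moving E \<and> abelian_germs E \<and>
     derived homeo_plus E = (\<Union>(a, b)\<in>{(a, b). a < b}. derived homeo_plus (supported_in E a b)) \<and>
     (\<forall>a b. a < b \<longrightarrow>
        (\<forall>f\<in>derived homeo_plus E.
           closure (Supp f) \<subseteq> {a<..<b} \<longrightarrow> f \<in> derived homeo_plus (supported_in E a b)))"

definition fg_filtered :: "(real \<Rightarrow> real) set \<Rightarrow> bool" where
  "fg_filtered E \<longleftrightarrow>
     (\<forall>a b. a < b \<longrightarrow>
        (\<exists>l r S. l < a \<and> b < r \<and>
           finite S \<and> S \<subseteq> derived homeo_plus (supported_in E l r) \<and>
           derived homeo_plus (supported_in E a b) \<subseteq> generate homeo_plus S))"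

definition tame_at_infinity :: "(real \<Rightarrow> real) set \<Rightarrow> bool" where
  "tame_at_infinity E \<longleftrightarrow>
     (\<forall>f\<in>E. \<exists>a. {a<..} \<subseteq> {x. f x = x} \<or> {a<..} \<subseteq> Supp f)"

definition trivial_near_infinity :: "(real \<Rightarrow> real) set \<Rightarrow> (real \<Rightarrow> real) set" where
  "trivial_near_infinity E = {f \<in> E. \<exists>a. \<forall>x\<in>{a<..}. f x = x}"

definition germs_at_infinity :: "(real \<Rightarrow> real) set \<Rightarrow> (real \<Rightarrow> real) set monoid" where
  "germs_at_infinity E = homeo_plus\<lparr>carrier := E\<rparr> Mod trivial_near_infinity E"

lemma group_homeo_plus: "group homeo_plus"
proof (rule groupI)
  fix f assume f: "f \<in> carrier homeo_plus"
  then obtain g where fg: "homeomorphism UNIV UNIV f g" and mono: "strict_mono f"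
    by (auto simp: homeo_plus_def)
  have eq: "f (g y) = y" "g (f y) = y" for y
    using fg by (auto simp: homeomorphism_def)
  have "strict_mono g"
    using mono eq(1) by (metis strict_mono_less strict_monoI)
  then have "g \<in> carrier homeo_plus"
    using homeomorphism_symD[OF fg] by (auto simp: homeo_plus_def)
  moreover have "g \<otimes>\<^bsub>homeo_plus\<^esub> f = \<one>\<^bsub>homeo_plus\<^esub>"
    using eq by (auto simp: homeo_plus_def)
  ultimately show "\<exists>g\<in>carrier homeo_plus. g \<otimes>\<^bsub>homeo_plus\<^esub> f = \<one>\<^bsub>homeo_plus\<^esub>"
    by blast
qed (auto simp: homeo_plus_def comp_assoc strict_mono_def
          intro: homeomorphism_compose homeomorphism_ident[unfolded id_def[symmetric]]
            exI[of _ id])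

lemma conc_prefix_suffix: "prefix k x \<frown> suffix k x = x"
  by (rule prefix_suffix[symmetric])

lemma prefix_conc: "prefix (length w) (w \<frown> x) = w"
  by (rule nth_equalityI) (auto simp: subsequence_def)

lemma group_thompson_V: "group thompson_V"
proof (rule groupI)
  fix f g assume "f \<in> carrier thompson_V" "g \<in> carrier thompson_V"
  then obtain f' g' where fg: "homeomorphism UNIV UNIV f f'" "homeomorphism UNIV UNIV g g'"
    and f: "\<And>\<kappa>. \<exists>k u. \<forall>x. f (prefix k \<kappa> \<frown> x) = u \<frown> x"
    and g: "\<And>\<kappa>. \<exists>k u. \<forall>x. g (prefix k \<kappa> \<frown> x) = u \<frown> x"
    by (auto simp: thompson_V_def)
  have "\<exists>k u. \<forall>x. g (f (prefix k \<kappa> \<frown> x)) = u \<frown> x" for \<kappa>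
  proof -
    obtain k u where ku: "\<And>x. f (prefix k \<kappa> \<frown> x) = u \<frown> x" using f by metis
    obtain m v where mv: "\<And>x. g (prefix m (f \<kappa>) \<frown> x) = v \<frown> x" using g by metis
    define y where "y = suffix k \<kappa>"
    have f\<kappa>: "f \<kappa> = u \<frown> y"
      using ku[of y] by (simp add: y_def conc_prefix_suffix)
    have pre: "prefix (k + m) \<kappa> = prefix k \<kappa> @ prefix m y"
      by (rule nth_equalityI) (auto simp: y_def subsequence_def nth_append)
    have split: "u \<frown> prefix m y \<frown> x = prefix m (f \<kappa>) \<frown> suffix m (u \<frown> prefix m y \<frown> x)" for x
      by (rule ext) (auto simp: f\<kappa> conc_def subsequence_def suffix_def nth_append)
    have drop_conc: "suffix m (w \<frown> x) = drop m w \<frown> x" if "m \<le> length w"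
      for w and x :: "bool word"
      by (rule ext) (use that in \<open>auto simp: conc_def suffix_def intro!: arg_cong[of _ _ x]\<close>)
    have suf: "suffix m (u \<frown> prefix m y \<frown> x) = drop m (u @ prefix m y) \<frown> x" for x
      unfolding conc_conc by (rule drop_conc) (simp add: subsequence_def)
    have "g (f (prefix (k + m) \<kappa> \<frown> x)) = (v @ drop m (u @ prefix m y)) \<frown> x" for x
    proof -
      have "f (prefix (k + m) \<kappa> \<frown> x) = u \<frown> prefix m y \<frown> x"
        unfolding pre conc_conc[symmetric] ku ..
      then show ?thesis
        by (metis split suf mv conc_conc)
    qed
    then show ?thesis by blast
  qed
  then show "f \<otimes>\<^bsub>thompson_V\<^esub> g \<in> carrier thompson_V"
    using homeomorphism_compose[OF fg] by (auto simp: thompson_V_def)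
next
  have "\<exists>k u. \<forall>x. id (prefix k \<kappa> \<frown> x) = u \<frown> x" for \<kappa> :: "bool word" by auto
  moreover have "homeomorphism UNIV UNIV (id :: bool word \<Rightarrow> bool word) id"
    by (simp add: homeomorphism_def id_def)
  ultimately show "\<one>\<^bsub>thompson_V\<^esub> \<in> carrier thompson_V"
    unfolding thompson_V_def by auto
next
  fix f assume "f \<in> carrier thompson_V"
  then obtain g where fg: "homeomorphism UNIV UNIV f g"
    and f: "\<And>\<kappa>. \<exists>k u. \<forall>x. f (prefix k \<kappa> \<frown> x) = u \<frown> x"
    by (auto simp: thompson_V_def)
  have eq: "f (g y) = y" "g (f y) = y" for y
    using fg by (auto simp: homeomorphism_def)
  have "\<exists>k u. \<forall>x. g (prefix k \<kappa> \<frown> x) = u \<frown> x" for \<kappa>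
  proof -
    obtain k u where ku: "\<And>x. f (prefix k (g \<kappa>) \<frown> x) = u \<frown> x" using f by metis
    have "\<kappa> = u \<frown> suffix k (g \<kappa>)"
      using ku[of "suffix k (g \<kappa>)"] by (simp add: conc_prefix_suffix eq)
    then have "prefix (length u) \<kappa> = u"
      by (metis prefix_conc)
    then have "g (prefix (length u) \<kappa> \<frown> x) = prefix k (g \<kappa>) \<frown> x" for x
      using ku eq(2) by metis
    then show ?thesis by blast
  qed
  then have "g \<in> carrier thompson_V"
    using homeomorphism_symD[OF fg] by (auto simp: thompson_V_def)
  moreover have "g \<otimes>\<^bsub>thompson_V\<^esub> f = \<one>\<^bsub>thompson_V\<^esub>"
    using eq by (auto simp: thompson_V_def)
  ultimately show "\<exists>g\<in>carrier thompson_V. g \<otimes>\<^bsub>thompson_V\<^esub> f = \<one>\<^bsub>thompson_V\<^esub>"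
    by blast
qed (auto simp: thompson_V_def comp_assoc)

lemma germ_kernel_normal:
  assumes "subgroup H homeo_plus" "N \<subseteq> H" "id \<in> N"
    and "\<And>f g. f \<in> N \<Longrightarrow> g \<in> N \<Longrightarrow> g \<circ> f \<in> N"
    and "\<And>f g. f \<in> N \<Longrightarrow> g \<in> H \<Longrightarrow> g \<circ> f = id \<Longrightarrow> g \<in> N"
    and "\<And>f h h'. f \<in> N \<Longrightarrow> h \<in> H \<Longrightarrow> h' \<in> H \<Longrightarrow> h \<circ> h' = id \<Longrightarrow> h' \<circ> f \<circ> h \<in> N"
  shows "N \<lhd> homeo_plus\<lparr>carrier := H\<rparr>"
proof -
  let ?H = "homeo_plus\<lparr>carrier := H\<rparr>"
  interpret H: group ?H
    by (rule subgroup.subgroup_is_group[OF assms(1) group_homeo_plus])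
  have mult: "f \<otimes>\<^bsub>homeo_plus\<^esub> g = g \<circ> f" for f g
    by (simp add: homeo_plus_def)
  have simps: "f \<otimes>\<^bsub>?H\<^esub> g = g \<circ> f" "\<one>\<^bsub>?H\<^esub> = id" "carrier ?H = H" for f g
    by (simp_all add: homeo_plus_def)
  have inv: "inv\<^bsub>?H\<^esub> f \<in> H" "inv\<^bsub>?H\<^esub> f \<circ> f = id" "f \<circ> inv\<^bsub>?H\<^esub> f = id" if "f \<in> H" for f
    using H.inv_closed[of f] H.r_inv[of f] H.l_inv[of f] that unfolding simps by auto
  have "subgroup N ?H"
    by (rule H.subgroupI) (use assms inv in \<open>auto simp: simps mult\<close>)
  then show ?thesis
    unfolding H.normal_inv_iff simps using assms(6) inv by (metis comp_assoc)
qed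

lemma subgroup_homeo_plusD:
  assumes "subgroup E homeo_plus"
  shows "id \<in> E"
    and "f \<in> E \<Longrightarrow> g \<in> E \<Longrightarrow> g \<circ> f \<in> E"
    and "f \<in> E \<Longrightarrow> strict_mono f"
    and "f \<in> E \<Longrightarrow> continuous_on UNIV f"
    and "f \<in> E \<Longrightarrow> \<exists>g\<in>E. g \<circ> f = id \<and> f \<circ> g = id"
proof -
  interpret group homeo_plus by (rule group_homeo_plus)
  interpret subgroup E homeo_plus by fact
  have simps: "f \<otimes>\<^bsub>homeo_plus\<^esub> g = g \<circ> f" "\<one>\<^bsub>homeo_plus\<^esub> = id" for f g
    by (simp_all add: homeo_plus_def)
  show "id \<in> E" using one_closed by (simp add: simps)
  show "f \<in> E \<Longrightarrow> g \<in> E \<Longrightarrow> g \<circ> f \<in> E" using m_closed[of f g] by (simp add: simps)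
  show "f \<in> E \<Longrightarrow> strict_mono f" "f \<in> E \<Longrightarrow> continuous_on UNIV f"
    using mem_carrier by (auto simp: homeo_plus_def homeomorphism_def)
  show "f \<in> E \<Longrightarrow> \<exists>g\<in>E. g \<circ> f = id \<and> f \<circ> g = id"
    using m_inv_closed[of f] r_inv[of f] l_inv[of f] mem_carrier[of f] unfolding simps by blast
qed

lemma subgroup_supported_in:
  assumes "subgroup E homeo_plus"
  shows "subgroup (supported_in E a b) homeo_plus"
proof -
  interpret group homeo_plus by (rule group_homeo_plus)
  interpret subgroup E homeo_plus by fact
  have simps: "f \<otimes>\<^bsub>homeo_plus\<^esub> g = g \<circ> f" "\<one>\<^bsub>homeo_plus\<^esub> = id" for f g
    by (simp_all add: homeo_plus_def)
  show ?thesis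
  proof (rule subgroupI)
    show "supported_in E a b \<subseteq> carrier homeo_plus"
      using subset by (auto simp: supported_in_def)
    show "supported_in E a b \<noteq> {}"
      using one_closed by (auto simp: supported_in_def Supp_def simps)
  next
    fix f g assume "f \<in> supported_in E a b" "g \<in> supported_in E a b"
    then show "f \<otimes>\<^bsub>homeo_plus\<^esub> g \<in> supported_in E a b"
      using m_closed[of f g] by (auto simp: supported_in_def Supp_def simps subset_iff) metis+
  next
    fix f assume f: "f \<in> supported_in E a b"
    then have "f \<in> E" by (simp add: supported_in_def)
    then have "inv\<^bsub>homeo_plus\<^esub> f \<in> E" "inv\<^bsub>homeo_plus\<^esub> f \<circ> f = id"
      using r_inv[of f] by (auto simp: simps)
    moreover have "(inv\<^bsub>homeo_plus\<^esub> f) x = x" if "f x = x" for x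
      using calculation(2) that by (metis comp_apply id_apply)
    ultimately show "inv\<^bsub>homeo_plus\<^esub> f \<in> supported_in E a b"
      using f by (auto simp: supported_in_def Supp_def)
  qed
qed

lemma trivial_near_infinity_normal:
  assumes E: "subgroup E homeo_plus"
  shows "trivial_near_infinity E \<lhd> homeo_plus\<lparr>carrier := E\<rparr>"
proof (rule germ_kernel_normal[OF E])
  show "trivial_near_infinity E \<subseteq> E" "id \<in> trivial_near_infinity E"
    using subgroup_homeo_plusD(1)[OF E] by (auto simp: trivial_near_infinity_def)
next
  fix f g assume fg: "f \<in> trivial_near_infinity E" "g \<in> trivial_near_infinity E"
  then obtain a b where "\<forall>x\<in>{a<..}. f x = x" "\<forall>x\<in>{b<..}. g x = x"
    by (auto simp: trivial_near_infinity_def)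
  then have "\<forall>x\<in>{max a b<..}. (g \<circ> f) x = x" by auto
  then show "g \<circ> f \<in> trivial_near_infinity E"
    using fg subgroup_homeo_plusD(2)[OF E] unfolding trivial_near_infinity_def by blast
next
  fix f g assume "f \<in> trivial_near_infinity E" "g \<in> E" "g \<circ> f = id"
  then show "g \<in> trivial_near_infinity E"
    unfolding trivial_near_infinity_def by clarsimp (metis comp_apply id_apply)
next
  fix f h h'
  assume f: "f \<in> trivial_near_infinity E" and h: "h \<in> E" "h' \<in> E" "h \<circ> h' = id"
  obtain a where a: "\<And>x. x > a \<Longrightarrow> f x = x"
    using f by (auto simp: trivial_near_infinity_def)
  have bij: "h' (h x) = x" "h (h' x) = x" for x
    using h(3) subgroup_homeo_plusD(3)[OF E h(1)]
    by (metis comp_apply id_apply strict_mono_eq)+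
  have "(h' \<circ> f \<circ> h) x = x" if "x > h' a" for x
  proof -
    have "h x > a" using that subgroup_homeo_plusD(3)[OF E h(1)] bij(2)
      by (metis strict_mono_less)
    then show ?thesis using a bij by simp
  qed
  moreover have "h' \<circ> f \<circ> h \<in> E"
    using f h subgroup_homeo_plusD(2)[OF E] by (auto simp: trivial_near_infinity_def)
  ultimately show "h' \<circ> f \<circ> h \<in> trivial_near_infinity E"
    by (auto simp: trivial_near_infinity_def)
qed

lemma subgroup_point_stabilizer:
  assumes E: "subgroup E homeo_plus"
  shows "subgroup (point_stabilizer E x) homeo_plus"
proof -
  interpret group homeo_plus by (rule group_homeo_plus)
  interpret subgroup E homeo_plus by fact
  have simps: "f \<otimes>\<^bsub>homeo_plus\<^esub> g = g \<circ> f" "\<one>\<^bsub>homeo_plus\<^esub> = id" for f g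
    by (simp_all add: homeo_plus_def)
  show ?thesis
  proof (rule subgroupI)
    show "point_stabilizer E x \<subseteq> carrier homeo_plus"
      using subset by (auto simp: point_stabilizer_def)
    show "point_stabilizer E x \<noteq> {}"
      using one_closed by (auto simp: point_stabilizer_def simps)
  next
    fix f g assume "f \<in> point_stabilizer E x" "g \<in> point_stabilizer E x"
    then show "f \<otimes>\<^bsub>homeo_plus\<^esub> g \<in> point_stabilizer E x"
      using m_closed[of f g] by (auto simp: point_stabilizer_def simps)
  next
    fix f assume f: "f \<in> point_stabilizer E x"
    then have "f \<in> E" "f x = x" by (auto simp: point_stabilizer_def)
    then have "inv\<^bsub>homeo_plus\<^esub> f \<in> E" "inv\<^bsub>homeo_plus\<^esub> f \<circ> f = id"
      using r_inv[of f] by (auto simp: simps)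
    then show "inv\<^bsub>homeo_plus\<^esub> f \<in> point_stabilizer E x"
      using \<open>f x = x\<close> by (simp add: point_stabilizer_def) (metis comp_apply id_apply)
  qed
qed

lemma trivial_near_normal:
  assumes E: "subgroup E homeo_plus"
  shows "trivial_near E x \<lhd> homeo_plus\<lparr>carrier := point_stabilizer E x\<rparr>"
proof (rule germ_kernel_normal[OF subgroup_point_stabilizer[OF E]])
  show "trivial_near E x \<subseteq> point_stabilizer E x" "id \<in> trivial_near E x"
    using subgroup_homeo_plusD(1)[OF E] by (auto simp: trivial_near_def point_stabilizer_def)
next
  fix f g assume fg: "f \<in> trivial_near E x" "g \<in> trivial_near E x"
  then obtain U W where "open U" "x \<in> U" "\<forall>y\<in>U. f y = y" "open W" "x \<in> W" "\<forall>y\<in>W. g y = y"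
    by (auto simp: trivial_near_def)
  then have "open (U \<inter> W)" "x \<in> U \<inter> W" "\<forall>y\<in>U \<inter> W. (g \<circ> f) y = y" by auto
  then show "g \<circ> f \<in> trivial_near E x"
    using fg subgroup_homeo_plusD(2)[OF E] unfolding trivial_near_def by blast
next
  fix f g assume "f \<in> trivial_near E x" "g \<in> point_stabilizer E x" "g \<circ> f = id"
  then show "g \<in> trivial_near E x"
    unfolding trivial_near_def point_stabilizer_def by clarsimp (metis comp_apply id_apply)
next
  fix f h h'
  assume f: "f \<in> trivial_near E x" and h': "h \<in> point_stabilizer E x" "h' \<in> point_stabilizer E x"
    and id: "h \<circ> h' = id"
  then have h: "h \<in> E" "h' \<in> E" "h x = x" by (auto simp: point_stabilizer_def)
  obtain U where U: "open U" "x \<in> U" "\<And>y. y \<in> U \<Longrightarrow> f y = y"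
    using f by (auto simp: trivial_near_def)
  have bij: "h' (h y) = y" for y
    using id subgroup_homeo_plusD(3)[OF E h(1)]
    by (metis comp_apply id_apply strict_mono_eq)
  have "open (h -` U)" "x \<in> h -` U"
    using U h subgroup_homeo_plusD(4)[OF E h(1)] by (auto intro: open_vimage)
  moreover have "\<forall>y\<in>h -` U. (h' \<circ> f \<circ> h) y = y"
    using U(3) bij by simp
  moreover have "h' \<circ> f \<circ> h \<in> E"
    using f h subgroup_homeo_plusD(2)[OF E] by (auto simp: trivial_near_def)
  ultimately show "h' \<circ> f \<circ> h \<in> trivial_near E x"
    unfolding trivial_near_def by blast
qed

end

theory Submission
  imports Defs
begin

text \<open>
  An element of \<open>V\<close> acts on small cones of Cantor space by replacing a prefix, and the difference
  of the two prefix lengths, here called the logarithmic slope, obeys the chain rule.  At a fixed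
  point it is therefore a homomorphism to the integers, and its kernel consists of the elements
  that are trivial near that point: germs in \<open>V\<close> are cyclic.  The proof finds, for \<open>f\<^sub>1, \<dots>, f\<^sub>n \<in>
  E\<close>, a point of Cantor space that plays the role of \<open>\<infinity>\<close>, so that the germs of \<open>\<langle>f\<^sub>1, \<dots>, f\<^sub>n\<rangle>\<close> at
  \<open>\<infinity>\<close> are controlled by logarithmic slopes there.

  The tool is the set of hyperbolic points of \<open>h \<in> V\<close>: the periodic points at which the return map
  has nonzero logarithmic slope.  This set is finite (\<open>finite_hyperbolic_points\<close>), it is preserved
  by every element of \<open>V\<close> that commutes with \<open>h\<close>, and a closed invariant set which avoids it
  consists of points of bounded period (\<open>hyperbolic_or_finite_order_on\<close>).  In particular an
  element of infinite order has hyperbolic points.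

  Let \<open>\<phi>\<close> embed \<open>E\<close> in \<open>V\<close>, and let \<open>E'\<close> be the commutator subgroup of \<open>E\<close>.  If \<open>g \<in> E\<close> is
  supported to the right of \<open>[a, b]\<close>, then all elements of \<open>E\<close> supported to the left of \<open>Supp g\<close>
  permute the finite set of hyperbolic points of \<open>\<phi> g\<close>.  Local moving provides such an element \<open>f\<close>
  that displaces \<open>[a, b]\<close>, and a power \<open>k\<close> of \<open>f\<close> acts trivially on the finite set.  For \<open>u, v\<close>
  supported in \<open>[a, b]\<close> the identity \<open>[u, v] = [[u, k], v]\<close> shows that \<open>E[a, b]'\<close> fixes these
  points too (\<open>derived_fixes_hyperbolic_points\<close>).  The same displacement trick writes commutators
  of elements of some \<open>E[a, b]\<close> as commutators of elements of \<open>E'\<close>.  Hence at a point fixed by all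
  of \<open>E'\<close> every element of \<open>E'\<close> has logarithmic slope zero (\<open>slope_0_if_derived_fixes\<close>).

  Limits of hyperbolic points of \<open>\<phi> g\<close>, as \<open>g \<in> E'\<close> moves off to \<open>\<infinity>\<close>, form a nonempty closed
  \<open>E\<close>-invariant set, the ends.  Each element of \<open>E'\<close> fixes every end and is trivial near it, so
  \<open>E\<close> acts on the ends, slopes included, through an abelian group.  Cutting down the set of ends
  with the dichotomy above, once for each \<open>f\<^sub>i\<close>, gives an end \<open>z\<close> that is fixed by \<open>f\<^sub>i\<^sup>k\<close> for all
  \<open>i\<close> and some \<open>k > 0\<close> (\<open>common_periodic_end\<close>).  Sending \<open>f\<close> to the slope of \<open>\<phi> (f\<^sup>k)\<close> at \<open>z\<close> is a
  homomorphism to the integers on a group containing all \<open>f\<^sub>i\<close>.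

  It remains to see that its kernel dies in the germs at \<open>\<infinity>\<close>.  Suppose that \<open>\<phi> f\<close> is the identity
  near \<open>z\<close>, but \<open>f\<close> has a nontrivial germ at \<open>\<infinity>\<close>.  By tameness \<open>f\<close> or its inverse pushes a whole
  ray to \<open>\<infinity>\<close>.  Near \<open>z\<close> there is a hyperbolic point \<open>y\<close> of \<open>\<phi> g\<close> for some \<open>g \<in> E'\<close> supported in
  this ray.  Conjugating \<open>g\<close> by powers of \<open>f\<close> moves its support to \<open>\<infinity>\<close>, but \<open>y\<close>, being fixed by \<open>\<phi>
  f\<close>, remains hyperbolic.  So all of \<open>E'\<close> fixes \<open>y\<close>, the slope of \<open>\<phi> g\<close> at \<open>y\<close> is zero, and \<open>y\<close> is
  not hyperbolic, a contradiction (\<open>trivial_germ_at_infinity_if_near_end\<close>).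
\<close>

section \<open>Prefix replacement on cones of Cantor space\<close>

text \<open>
  Inverse functions get a name of their own, since the symbol \<open>inv\<close> denotes inverses in a group.
\<close>
abbreviation inv_fun :: "('a \<Rightarrow> 'b) \<Rightarrow> 'b \<Rightarrow> 'a" where
  "inv_fun f \<equiv> inv_into UNIV f"

definition maps_cone :: "(bool word \<Rightarrow> bool word) \<Rightarrow> bool list \<Rightarrow> bool list \<Rightarrow> bool" where
  "maps_cone h p u \<longleftrightarrow> (\<forall>y. h (p \<frown> y) = u \<frown> y)"

lemma maps_coneD: "maps_cone h p u \<Longrightarrow> h (p \<frown> y) = u \<frown> y"
  by (simp add: maps_cone_def)

lemma maps_cone_append: "maps_cone h p u \<Longrightarrow> maps_cone h (p @ s) (u @ s)"
  unfolding maps_cone_def by (metis conc_conc)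

lemma maps_cone_comp: "maps_cone h p u \<Longrightarrow> maps_cone g u v \<Longrightarrow> maps_cone (g \<circ> h) p v"
  by (simp add: maps_cone_def)

lemma maps_cone_inv: "bij h \<Longrightarrow> maps_cone h p u \<Longrightarrow> maps_cone (inv_fun h) u p"
  unfolding maps_cone_def by (metis bij_inv_eq_iff)

lemma prefix_append_segment: "m \<le> n \<Longrightarrow> prefix n x = prefix m x @ (x [m \<rightarrow> n])"
  using subsequence_append[where i = m and j = "n - m" and w = x] by simp

lemma prefix_eq_mono: "prefix n x = prefix n y \<Longrightarrow> m \<le> n \<Longrightarrow> prefix m x = prefix m y"
  by (metis append_eq_append_conv diff_zero prefix_append_segment subsequence_length)

lemma prefixes_eq_imp_eq:
  assumes "\<And>m. prefix m x = prefix m y"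
  shows "x = y"
proof
  fix i show "x i = y i"
    using assms[of "Suc i"] by simp
qed

lemma concs_agree_imp_eq:
  fixes u v :: "bool list"
  assumes "\<And>y. u \<frown> y = v \<frown> y"
  shows "u = v"
proof -
  have *: "u = v" if le: "length u \<le> length v" and eq: "\<And>y. u \<frown> y = v \<frown> y"
    for u v :: "bool list"
  proof -
    define s where "s = drop (length u) v"
    have "take (length u) v = u"
      using eq le prefix_conc_fst[of "length u" v] prefix_conc_length by metis
    then have v: "v = u @ s"
      by (metis append_take_drop_id s_def)
    have "s = []"
    proof (rule ccontr)
      assume "s \<noteq> []"
      moreover have "(\<lambda>_. \<not> hd s) = s \<frown> (\<lambda>_. \<not> hd s)"
        using eq[of "\<lambda>_. \<not> hd s"] unfolding v conc_conc[symmetric] same_concat_eq .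
      ultimately show False
        by (metis conc_fst hd_conv_nth length_greater_0_conv)
    qed
    then show ?thesis using v by simp
  qed
  show ?thesis
    using *[of u v] *[of v u] assms by (metis nle_le)
qed

lemma maps_cone_unique: "maps_cone h p u \<Longrightarrow> maps_cone h p v \<Longrightarrow> u = v"
  by (rule concs_agree_imp_eq) (simp add: maps_cone_def)

text \<open>
  Compactness of Cantor space in the form of a bar induction: a word with arbitrarily long
  extensions that violate \<open>Q\<close> has a one-letter extension of the same kind, and following these
  letters forever gives a sequence that is never barred.
\<close>
lemma cone_compactness:
  fixes Q :: "bool list \<Rightarrow> bool"
  assumes ext: "\<And>p s. Q p \<Longrightarrow> Q (p @ s)" and bar: "\<And>x. \<exists>k. Q (prefix k x)"
  obtains N where "\<And>p. N \<le> length p \<Longrightarrow> Q p"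
proof -
  define bad where "bad p \<longleftrightarrow> (\<forall>N. \<exists>s. N \<le> length s \<and> \<not> Q (p @ s))" for p
  have step: "\<exists>b. bad (p @ [b])" if "bad p" for p
  proof (rule ccontr)
    assume "\<nexists>b. bad (p @ [b])"
    then obtain M where M: "\<And>b s. M b \<le> length s \<Longrightarrow> Q (p @ b # s)"
      unfolding bad_def by simp metis
    obtain s where s: "Suc (max (M True) (M False)) \<le> length s" "\<not> Q (p @ s)"
      using \<open>bad p\<close> unfolding bad_def by blast
    then obtain b t where "s = b # t" by (cases s) auto
    then show False using s M[of b t] by (cases b) auto
  qed
  have "\<not> bad []"
  proof
    assume "bad []"
    define w where "w = rec_nat [] (\<lambda>_ p. p @ [SOME b. bad (p @ [b])])"
    have w: "w 0 = []" "w (Suc n) = w n @ [SOME b. bad (w n @ [b])]" for n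
      by (simp_all add: w_def)
    have "bad (w n)" for n
    proof (induction n)
      case (Suc n)
      show ?case unfolding w using someI_ex[OF step[OF Suc]] .
    qed (simp add: w \<open>bad []\<close>)
    moreover define x where "x n = w (Suc n) ! n" for n
    have len: "length (w n) = n" for n by (induction n) (simp_all add: w)
    have "prefix n x = w n" for n
      by (induction n) (simp_all add: w x_def len nth_append)
    ultimately show False
      using bar[of x] ext unfolding bad_def by metis
  qed
  then obtain N where "\<And>s. N \<le> length s \<Longrightarrow> Q s"
    unfolding bad_def by auto
  then show thesis by (rule that)
qed

abbreviation V :: "(bool word \<Rightarrow> bool word) set" where
  "V \<equiv> carrier thompson_V"

lemma V_bij: "h \<in> V \<Longrightarrow> bij h"
  unfolding thompson_V_def by (clarsimp simp: homeomorphism_def) (metis bijI')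

lemma V_maps_cone: "h \<in> V \<Longrightarrow> \<exists>k u. maps_cone h (prefix k x) u"
  by (simp add: thompson_V_def maps_cone_def)

lemma V_id: "id \<in> V"
  using monoid.one_closed[OF group.is_monoid[OF group_thompson_V]] by (simp add: thompson_V_def)

lemma V_comp: "h \<in> V \<Longrightarrow> g \<in> V \<Longrightarrow> g \<circ> h \<in> V"
  using monoid.m_closed[OF group.is_monoid[OF group_thompson_V], of h g]
  by (simp add: thompson_V_def)

lemma V_funpow: "h \<in> V \<Longrightarrow> h ^^ n \<in> V"
  by (induction n) (auto intro: V_comp simp: V_id)

lemma V_inv:
  assumes "h \<in> V"
  shows "inv_fun h \<in> V"
proof -
  interpret group thompson_V by (rule group_thompson_V)
  have "inv\<^bsub>thompson_V\<^esub> h \<circ> h = id"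
    using r_inv[OF assms] by (simp add: thompson_V_def)
  then have "inv_fun h = inv\<^bsub>thompson_V\<^esub> h"
    by (metis V_bij assms bij_is_surj comp_assoc comp_id id_comp surj_iff)
  then show ?thesis using assms by simp
qed

lemma V_maps_cone_long:
  assumes "h \<in> V"
  obtains m u where "M \<le> m" "L \<le> length u" "maps_cone h (prefix m x) u"
proof -
  obtain k u where ku: "maps_cone h (prefix k x) u" using V_maps_cone[OF assms] by blast
  have "maps_cone h (prefix (k + (M + L)) x) (u @ (x [k \<rightarrow> k + (M + L)]))"
    using maps_cone_append[OF ku] by (metis subsequence_append)
  then show thesis by (intro that[of "k + (M + L)"]) simp_all
qed

lemma maps_cone_prefix_eq:
  assumes "maps_cone h (prefix m x) u"
  shows "prefix (length u) (h x) = u" "h x = u \<frown> suffix m x"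
proof -
  show "h x = u \<frown> suffix m x" using maps_coneD[OF assms, of "suffix m x"] by simp
  then show "prefix (length u) (h x) = u" by simp
qed

lemma V_continuous:
  assumes "h \<in> V"
  obtains m where "M \<le> m" "\<And>y. prefix m y = prefix m x \<Longrightarrow> prefix l (h y) = prefix l (h x)"
proof -
  obtain m u where mu: "M \<le> m" "l \<le> length u" "maps_cone h (prefix m x) u"
    by (rule V_maps_cone_long[OF assms])
  show thesis
  proof (rule that)
    fix y assume "prefix m y = prefix m x"
    then have "prefix (length u) (h y) = prefix (length u) (h x)"
      using mu(3) maps_cone_prefix_eq(1) by metis
    then show "prefix l (h y) = prefix l (h x)" using mu(2) by (rule prefix_eq_mono)
  qed fact
qed

lemma V_uniform_depth:
  assumes "h \<in> V"
  obtains N where "\<And>p. N \<le> length p \<Longrightarrow> \<exists>u. maps_cone h p u"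
proof (rule cone_compactness[of "\<lambda>p. \<exists>u. maps_cone h p u"])
  show "\<And>x. \<exists>k u. maps_cone h (prefix k x) u" using V_maps_cone[OF assms] .
qed (use maps_cone_append that in blast)+

section \<open>Logarithmic slopes\<close>

text \<open>
  If \<open>h\<close> replaces a prefix of length \<open>m\<close> of \<open>x\<close> by a word of length \<open>l\<close>, then it scales the usual
  measure near \<open>x\<close> by \<open>2 ^ (m - l)\<close>, and the exponent is recorded.  By \<open>log_slope_eq\<close> it does not
  depend on the chosen prefix, provided that there is one.
\<close>
definition log_slope :: "(bool word \<Rightarrow> bool word) \<Rightarrow> bool word \<Rightarrow> int" where
  "log_slope h x = (THE d. \<exists>m u. maps_cone h (prefix m x) u \<and> d = int m - int (length u))"

lemma log_slope_eq:
  assumes "maps_cone h (prefix m x) u"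
  shows "log_slope h x = int m - int (length u)"
proof -
  have *: "int k - int (length v) = int m - int (length u)"
    if "m \<le> k" "maps_cone h (prefix m x) u" "maps_cone h (prefix k x) v" for m k u v
  proof -
    have "maps_cone h (prefix k x) (u @ (x [m \<rightarrow> k]))"
      using that prefix_append_segment[OF that(1)] maps_cone_append by metis
    then have "v = u @ (x [m \<rightarrow> k])" using that(3) maps_cone_unique by blast
    then show ?thesis using that(1) by simp
  qed
  have "int k - int (length v) = int m - int (length u)"
    if "maps_cone h (prefix k x) v" for k v
    using *[of m k u v] *[of k m v u] that assms by (metis nle_le)
  then show ?thesis
    unfolding log_slope_def using assms by (intro the_equality) blast+
qed

text \<open>
  The chain rule: a long enough prefix of \<open>x\<close> is mapped to a word in which the prefix needed by
  \<open>g\<close> is contained, so both replacements can be performed one after the other.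
\<close>
lemma log_slope_comp:
  assumes "h \<in> V" "g \<in> V"
  shows "log_slope (g \<circ> h) x = log_slope h x + log_slope g (h x)"
proof -
  obtain k v where kv: "maps_cone g (prefix k (h x)) v" using V_maps_cone[OF assms(2)] by blast
  obtain m u where mu: "k \<le> length u" "maps_cone h (prefix m x) u"
    by (rule V_maps_cone_long[OF assms(1)])
  have "u = prefix k (h x) @ ((h x) [k \<rightarrow> length u])"
    using maps_cone_prefix_eq(1)[OF mu(2)] prefix_append_segment[OF mu(1), of "h x"] by simp
  then obtain t where u: "u = prefix k (h x) @ t" by blast
  have g: "maps_cone g u (v @ t)" using maps_cone_append[OF kv] u by metis
  then have "log_slope g (h x) = int (length u) - int (length (v @ t))"
    by (intro log_slope_eq) (simp add: maps_cone_prefix_eq(1)[OF mu(2)])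
  then show ?thesis
    using log_slope_eq[OF mu(2)] log_slope_eq[OF maps_cone_comp[OF mu(2) g]] by simp
qed

lemma log_slope_id: "log_slope id x = 0"
  using log_slope_eq[where h = id and m = 0 and x = x and u = "[]"] by (simp add: maps_cone_def)

lemma log_slope_inv:
  assumes "h \<in> V"
  shows "log_slope (inv_fun h) (h x) = - log_slope h x"
  using log_slope_comp[OF assms V_inv[OF assms], of x] V_bij[OF assms] log_slope_id[of x]
  by (simp add: bij_is_inj)

text \<open>
  A fixed point forces the old and the new prefix to be comparable, and slope zero to have the
  same length.  So at a fixed point the germ in \<open>V\<close> is determined by an integer.
\<close>
lemma log_slope_0_imp_locally_id:
  assumes "h \<in> V" "h x = x" "log_slope h x = 0"
  obtains m where "\<And>y. prefix m y = prefix m x \<Longrightarrow> h y = y"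
proof -
  obtain m u where mu: "maps_cone h (prefix m x) u" using V_maps_cone[OF assms(1)] by blast
  have "length u = m" using log_slope_eq[OF mu] assms(3) by simp
  then have u: "u = prefix m x" using maps_cone_prefix_eq(1)[OF mu] assms(2) by simp
  show thesis
  proof (rule that)
    fix y assume "prefix m y = prefix m x"
    then show "h y = y" using maps_coneD[OF mu, of "suffix m y"] u by (metis prefix_suffix)
  qed
qed

lemma log_slope_funpow:
  assumes "h \<in> V" "h x = x"
  shows "(h ^^ n) x = x" "log_slope (h ^^ n) x = int n * log_slope h x"
proof -
  show *: "(h ^^ n) x = x" for n by (induction n) (simp_all add: assms)
  show "log_slope (h ^^ n) x = int n * log_slope h x"
  proof (induction n)
    case (Suc n)
    have "log_slope (h ^^ Suc n) x = log_slope (h ^^ n) x + log_slope h ((h ^^ n) x)"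
      unfolding funpow.simps by (rule log_slope_comp) (simp_all add: V_funpow assms)
    then show ?case unfolding Suc * by (simp add: algebra_simps del: funpow.simps)
  qed (simp add: log_slope_id flip: id_def)
qed

section \<open>Hyperbolic points of elements of Thompson's group V\<close>

text \<open>
  These are the attracting (slope negative) and the repelling (slope positive) periodic points.
\<close>
definition hyperbolic_points :: "(bool word \<Rightarrow> bool word) \<Rightarrow> bool word set" where
  "hyperbolic_points h = {x. \<exists>n>0. (h ^^ n) x = x \<and> log_slope (h ^^ n) x \<noteq> 0}"

lemma funpow_inv: fixes h :: "'a \<Rightarrow> 'a" shows "bij h \<Longrightarrow> inv_fun h ^^ n = inv_fun (h ^^ n)"
  using inv_fn[of h n] by simp

lemma hyperbolic_points_inv_subset:
  assumes "h \<in> V"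
  shows "hyperbolic_points h \<subseteq> hyperbolic_points (inv_fun h)"
proof
  fix x assume "x \<in> hyperbolic_points h"
  then obtain n where n: "n > 0" "(h ^^ n) x = x" "log_slope (h ^^ n) x \<noteq> 0"
    by (auto simp: hyperbolic_points_def)
  have "(inv_fun h ^^ n) x = x"
    using n(2) V_bij[OF V_funpow[OF assms, of n]] funpow_inv[OF V_bij[OF assms]]
    by (metis bij_inv_eq_iff)
  moreover have "log_slope (inv_fun h ^^ n) x \<noteq> 0"
    using log_slope_inv[OF V_funpow[OF assms], of n x] n funpow_inv[OF V_bij[OF assms]] by simp
  ultimately show "x \<in> hyperbolic_points (inv_fun h)"
    using n(1) by (auto simp: hyperbolic_points_def)
qed

lemma hyperbolic_points_inv:
  assumes "h \<in> V"
  shows "hyperbolic_points (inv_fun h) = hyperbolic_points h"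
  using hyperbolic_points_inv_subset[OF assms] hyperbolic_points_inv_subset[OF V_inv[OF assms]]
    V_bij[OF assms] by (simp add: inv_inv_eq)

lemma funpow_fixed_mult: "(f ^^ n) x = x \<Longrightarrow> (f ^^ (n * k)) x = x"
  by (induction k) (simp_all add: funpow_add)

lemma maps_cone_funpow_diff:
  assumes "maps_cone (h ^^ j) p u" "maps_cone (h ^^ k) p v" "j \<le> k"
  shows "maps_cone (h ^^ (k - j)) u v"
  unfolding maps_cone_def
proof
  fix y
  have "(h ^^ (k - j)) (u \<frown> y) = (h ^^ (k - j + j)) (p \<frown> y)"
    unfolding funpow_add using maps_coneD[OF assms(1)] by simp
  then show "(h ^^ (k - j)) (u \<frown> y) = v \<frown> y"
    using assms(2,3) by (simp add: maps_cone_def)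
qed

lemma maps_cone_funpow:
  assumes "maps_cone g u (u @ s)"
  shows "maps_cone (g ^^ i) u (u @ concat (replicate i s))"
proof (induction i)
  case (Suc i)
  have "maps_cone (g \<circ> g ^^ i) u ((u @ s) @ concat (replicate i s))"
    using maps_cone_comp[OF Suc maps_cone_append[OF assms]] .
  then show ?case by (simp only: funpow.simps replicate.simps concat.simps append_assoc)
qed (simp add: maps_cone_def)

lemma length_concat_replicate: "s \<noteq> [] \<Longrightarrow> i \<le> length (concat (replicate i s))"
proof (induction i)
  case (Suc i)
  then have "1 \<le> length s" by (simp add: Suc_leI)
  then show ?case using Suc by simp
qed simp

lemma concat_replicate_iter:
  assumes "s \<noteq> []"
  shows "concat (replicate i s) \<frown> s\<^sup>\<omega> = s\<^sup>\<omega>"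
proof (induction i)
  case (Suc i)
  have "concat (replicate (Suc i) s) \<frown> s\<^sup>\<omega> = s \<frown> concat (replicate i s) \<frown> s\<^sup>\<omega>" by simp
  also have "\<dots> = s\<^sup>\<omega>" unfolding Suc using iter_unroll[of s] assms by simp
  finally show ?case .
qed simp

lemma prefix_length_appendD:
  "prefix (length (p @ s)) x = p @ s \<Longrightarrow> prefix (length p) x = p"
  using prefix_append_segment[of "length p" "length (p @ s)" x] by simp

text \<open>
  Compactness again: a family of points indexed by an infinite set accumulates somewhere.
\<close>
lemma finite_if_locally_finite:
  fixes f :: "'a \<Rightarrow> bool word"
  assumes "\<And>y. \<exists>m. finite {a \<in> A. prefix m (f a) = prefix m y}"
  shows "finite A"
proof (rule cone_compactness[of "\<lambda>p. finite {a \<in> A. prefix (length p) (f a) = p}"])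
  fix p s assume *: "finite {a \<in> A. prefix (length p) (f a) = p}"
  show "finite {a \<in> A. prefix (length (p @ s)) (f a) = p @ s}"
    by (rule finite_subset[OF _ *]) (use prefix_length_appendD in blast)
next
  fix N assume N: "\<And>p. N \<le> length p \<Longrightarrow> finite {a \<in> A. prefix (length p) (f a) = p}"
  have "finite {p::bool list. length p = N}"
    using finite_lists_length_eq[of "UNIV :: bool set" N] by simp
  then have "finite (\<Union>p\<in>{p. length p = N}. {a \<in> A. prefix (length p) (f a) = p})"
    using N by (intro finite_UN_I) auto
  then show "finite A" by (rule rev_finite_subset) auto
qed (use assms in simp)

lemma accumulation_point:
  fixes X :: "nat \<Rightarrow> bool word"
  obtains y where "\<And>m. infinite {n. prefix m (X n) = prefix m y}"
  using finite_if_locally_finite[of UNIV X] by auto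

text \<open>
  If no prefix of \<open>x\<close> is long enough to be replaced by all iterates of \<open>h\<close>, then for every prefix
  there is a first iterate that fails, and just before it the prefix has become a word of length
  less than \<open>N\<close>, the depth at which \<open>h\<close> replaces prefixes.  There are finitely many such words, so
  two prefixes of \<open>x\<close> are sent to the same word \<open>u\<close>; comparing the two iterates shows that some
  iterate properly contracts the cone of \<open>u\<close> into itself, or expands it.
\<close>
lemma scaling_cone_of_unbounded_orbit:
  assumes "h \<in> V" and nonrigid: "\<And>M. \<exists>n. \<nexists>u. maps_cone (h ^^ n) (prefix M x) u"
  obtains n u y d s where "(h ^^ n) x = u \<frown> y" "0 < d" "s \<noteq> []"
    "maps_cone (h ^^ d) u (u @ s) \<or> maps_cone (h ^^ d) (u @ s) u"
proof -
  obtain N where N: "\<And>p. N \<le> length p \<Longrightarrow> \<exists>u. maps_cone h p u"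
    by (rule V_uniform_depth[OF assms(1)]) blast
  have "\<exists>n u. length u < N \<and> maps_cone (h ^^ n) (prefix M x) u" for M
  proof -
    define n where "n = (LEAST n. \<nexists>u. maps_cone (h ^^ n) (prefix M x) u)"
    have n: "\<nexists>u. maps_cone (h ^^ n) (prefix M x) u"
      unfolding n_def by (rule LeastI_ex[OF nonrigid])
    have "n \<noteq> 0"
    proof
      assume "n = 0"
      then have "maps_cone (h ^^ n) (prefix M x) (prefix M x)" by (simp add: maps_cone_def)
      then show False using n by blast
    qed
    then obtain k where k: "n = Suc k" using not0_implies_Suc by blast
    then obtain u where u: "maps_cone (h ^^ k) (prefix M x) u"
      using not_less_Least[of k "\<lambda>n. \<nexists>u. maps_cone (h ^^ n) (prefix M x) u"]
      unfolding n_def by auto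
    moreover have "length u < N"
    proof (rule ccontr)
      assume "\<not> length u < N"
      then obtain v where "maps_cone h u v" using N by (meson not_less)
      from maps_cone_comp[OF u this] show False using n unfolding k by auto
    qed
    ultimately show ?thesis by blast
  qed
  then obtain n u where nu: "\<And>M. length (u M) < N" "\<And>M. maps_cone (h ^^ n M) (prefix M x) (u M)"
    by metis
  have "finite (u ` UNIV)"
    by (rule finite_subset[OF _ finite_lists_length_le[of "UNIV :: bool set" N]])
      (use nu(1) less_imp_le in auto)
  then obtain M\<^sub>0 where "infinite {M. u M = u M\<^sub>0}"
    using pigeonhole_infinite[of UNIV u] by auto
  then obtain M' where M': "M\<^sub>0 < M'" "u M' = u M\<^sub>0"
    unfolding infinite_nat_iff_unbounded by blast
  define s where "s = x [M\<^sub>0 \<rightarrow> M']"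
  have s: "s \<noteq> []" using M'(1) by (simp add: s_def)
  have "prefix M' x = prefix M\<^sub>0 x @ s"
    using prefix_append_segment[of M\<^sub>0 M' x] M'(1) by (simp add: s_def)
  then have m: "maps_cone (h ^^ n M\<^sub>0) (prefix M' x) (u M\<^sub>0 @ s)"
    using maps_cone_append[OF nu(2)[of M\<^sub>0]] by simp
  have m': "maps_cone (h ^^ n M') (prefix M' x) (u M\<^sub>0)"
    using nu(2)[of M'] M'(2) by simp
  \<comment> \<open>The same iterate cannot send a word and a proper extension of it to the same word.\<close>
  have "n M\<^sub>0 \<noteq> n M'"
    using m m' maps_cone_unique s by (metis append_self_conv)
  then consider "n M\<^sub>0 < n M'" | "n M' < n M\<^sub>0" by linarith
  then have "\<exists>d>0. maps_cone (h ^^ d) (u M\<^sub>0) (u M\<^sub>0 @ s) \<or> maps_cone (h ^^ d) (u M\<^sub>0 @ s) (u M\<^sub>0)"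
    using maps_cone_funpow_diff[OF m m'] maps_cone_funpow_diff[OF m' m]
    by cases (meson less_imp_le zero_less_diff)+
  then show thesis
    using that maps_cone_prefix_eq(2)[OF nu(2)[of M\<^sub>0]] s by blast
qed

text \<open>
  Closedness in Cantor space, in terms of prefixes.
\<close>
definition cone_closed :: "bool word set \<Rightarrow> bool" where
  "cone_closed T \<longleftrightarrow> (\<forall>x. (\<forall>m. \<exists>y\<in>T. prefix m y = prefix m x) \<longrightarrow> x \<in> T)"

text \<open>
  Iterating \<open>h ^^ d\<close> on the cone of \<open>u\<close> accumulates the word \<open>s\<close>, so the orbit of any point of
  that cone converges to \<open>u\<close> followed by infinitely many copies of \<open>s\<close>.
\<close>
lemma attracting_point_in_closed_set:
  assumes "h \<in> V" "cone_closed T" "\<And>x. x \<in> T \<Longrightarrow> h x \<in> T" "u \<frown> y \<in> T"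
    and d: "0 < d" "s \<noteq> []" "maps_cone (h ^^ d) u (u @ s)"
  shows "u \<frown> s\<^sup>\<omega> \<in> T \<inter> hyperbolic_points h"
proof
  have "(h ^^ n) x \<in> T" if "x \<in> T" for n x
    using that by (induction n) (simp_all add: assms(3))
  then have T: "(u @ concat (replicate i s)) \<frown> y \<in> T" for i
    using maps_coneD[OF maps_cone_funpow[OF d(3), of i], of y] assms(4)
    by (metis funpow_mult)
  have "prefix i ((u @ concat (replicate i s)) \<frown> y) = prefix i (u \<frown> s\<^sup>\<omega>)" for i
  proof -
    have le: "i \<le> length (u @ concat (replicate i s))"
      using length_concat_replicate[OF d(2), of i] by simp
    have "u \<frown> s\<^sup>\<omega> = (u @ concat (replicate i s)) \<frown> s\<^sup>\<omega>"
      using concat_replicate_iter[OF d(2), of i] by (metis conc_conc)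
    then show ?thesis using prefix_conc_fst[OF le] by metis
  qed
  then show "u \<frown> s\<^sup>\<omega> \<in> T"
    using assms(2) T unfolding cone_closed_def by blast
  have "(h ^^ d) (u \<frown> s\<^sup>\<omega>) = u \<frown> s \<frown> s\<^sup>\<omega>"
    using maps_coneD[OF d(3)] by simp
  then have fixed: "(h ^^ d) (u \<frown> s\<^sup>\<omega>) = u \<frown> s\<^sup>\<omega>"
    using iter_unroll[of s] d(2) by simp
  have "log_slope (h ^^ d) (u \<frown> s\<^sup>\<omega>) = int (length u) - int (length (u @ s))"
    by (rule log_slope_eq) (use d(3) in simp)
  then show "u \<frown> s\<^sup>\<omega> \<in> hyperbolic_points h"
    using fixed d(1,2) by (auto simp: hyperbolic_points_def)
qed

lemma hyperbolic_point_of_scaling_cone: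
  assumes "h \<in> V" "cone_closed T"
    and inv: "\<And>x. x \<in> T \<Longrightarrow> h x \<in> T" "\<And>x. x \<in> T \<Longrightarrow> inv_fun h x \<in> T"
    and d: "u \<frown> y \<in> T" "0 < d" "s \<noteq> []"
      "maps_cone (h ^^ d) u (u @ s) \<or> maps_cone (h ^^ d) (u @ s) u"
  shows "T \<inter> hyperbolic_points h \<noteq> {}"
  using d(4)
proof
  assume "maps_cone (h ^^ d) u (u @ s)"
  then show ?thesis using attracting_point_in_closed_set[OF assms(1,2) inv(1) d(1-3)] by auto
next
  assume "maps_cone (h ^^ d) (u @ s) u"
  then have "maps_cone (inv_fun h ^^ d) u (u @ s)"
    using maps_cone_inv V_bij V_funpow assms(1) by (metis funpow_inv)
  then show ?thesis
    using attracting_point_in_closed_set[OF V_inv[OF assms(1)] assms(2) inv(2) d(1-3)]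
      hyperbolic_points_inv[OF assms(1)] by auto
qed

text \<open>
  By the preceding lemmas no iterate of \<open>h\<close> maps a cone that meets \<open>T\<close> properly into itself, and
  each point of \<open>T\<close> has a prefix that all iterates replace.  Suppose that the orbit of \<open>x \<in> T\<close> is
  infinite.  Then the words \<open>w n\<close> that replace the prefix of \<open>x\<close> become long.  Let \<open>y\<close> be an
  accumulation point of the orbit, with prefix \<open>q\<close> replaced by all iterates.  The orbit enters the
  cone of \<open>q\<close> at two times, the second time with a longer word, so between these times the cone of
  \<open>q\<close> has been contracted into itself.
\<close>
lemma periodic_if_no_hyperbolic_point:
  assumes "h \<in> V" "cone_closed T"
    and inv: "\<And>x. x \<in> T \<Longrightarrow> h x \<in> T" "\<And>x. x \<in> T \<Longrightarrow> inv_fun h x \<in> T"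
    and none: "T \<inter> hyperbolic_points h = {}" and "x \<in> T"
  shows "\<exists>n>0. (h ^^ n) x = x"
proof (rule ccontr)
  assume aperiodic: "\<not> ?thesis"
  have invn: "(h ^^ n) x \<in> T" if "x \<in> T" for n x
    using that by (induction n) (simp_all add: inv)
  have scaling: "\<not> maps_cone (h ^^ d) u (u @ s) \<and> \<not> maps_cone (h ^^ d) (u @ s) u"
    if "u \<frown> y \<in> T" "0 < d" "s \<noteq> []" for u y d s
    using hyperbolic_point_of_scaling_cone[OF assms(1,2) inv that] none by blast
  have rigid: "\<exists>M w. \<forall>n. maps_cone (h ^^ n) (prefix M z) (w n)" if "z \<in> T" for z
  proof (rule ccontr)
    assume "\<not> ?thesis"
    then have "\<And>M. \<exists>n. \<nexists>u. maps_cone (h ^^ n) (prefix M z) u" by metis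
    then obtain n u y d s where "(h ^^ n) z = u \<frown> y" "0 < d" "s \<noteq> []"
      "maps_cone (h ^^ d) u (u @ s) \<or> maps_cone (h ^^ d) (u @ s) u"
      by (rule scaling_cone_of_unbounded_orbit[OF assms(1)])
    then show False using scaling invn[OF that] by metis
  qed
  obtain M w where w: "\<And>n. maps_cone (h ^^ n) (prefix M x) (w n)" using rigid[OF assms(6)] by blast
  have w_x: "(h ^^ n) x = w n \<frown> suffix M x" for n using maps_cone_prefix_eq(2)[OF w] .
  have "(h ^^ n) x \<noteq> (h ^^ k) x" if "n < k" for n k
  proof
    assume "(h ^^ n) x = (h ^^ k) x"
    then have "(h ^^ n) x = (h ^^ n) ((h ^^ (k - n)) x)"
      using that by (metis add_diff_inverse_nat comp_apply funpow_add less_imp_not_less)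
    then have "(h ^^ (k - n)) x = x"
      using V_bij[OF V_funpow[OF assms(1), of n]] by (metis bij_is_inj inj_eq)
    then show False using that aperiodic zero_less_diff by blast
  qed
  then have "inj w"
    by (intro linorder_injI) (metis w_x)
  then have short: "finite {n. length (w n) \<le> B}" for B
    using finite_vimageI[OF finite_lists_length_le[of "UNIV :: bool set" B]]
    by (simp add: vimage_def)
  obtain y where y: "\<And>m. infinite {n. prefix m ((h ^^ n) x) = prefix m y}"
    using accumulation_point[of "\<lambda>n. (h ^^ n) x"] by blast
  have "\<exists>z\<in>T. prefix m z = prefix m y" for m
    using not_finite_existsD[OF y[of m]] invn[OF assms(6)] by blast
  then have "y \<in> T" using assms(2) unfolding cone_closed_def by blast
  then obtain M' v where v: "\<And>n. maps_cone (h ^^ n) (prefix M' y) (v n)" using rigid by blast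
  define q where "q = prefix M' y"
  define I where "I = {n. prefix M' ((h ^^ n) x) = q}"
  have far: "\<exists>n\<in>I. n > k \<and> length (w n) > B" for k B
  proof (rule ccontr)
    assume "\<not> ?thesis"
    then have "I \<subseteq> {..k} \<union> {n. length (w n) \<le> B}" by force
    then show False using y[of M'] short[of B] finite_subset unfolding I_def q_def by blast
  qed
  have split: "take M' (w n) = q" if "n \<in> I" "length (w n) \<ge> M'" for n
    using that prefix_conc_fst[OF that(2), of "suffix M x"] w_x[of n] by (simp add: I_def)
  \<comment> \<open>The two visits to the cone of \<open>q\<close>, at times \<open>n < k\<close>.\<close>
  obtain n where n: "n \<in> I" "length (w n) > M'" using far by blast
  obtain k where k: "k \<in> I" "k > n" "length (w k) > length (w n)" using far by blast
  define t where "t = drop M' (w n)"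
  have wn: "w n = q @ t" using split[of n] n by (metis append_take_drop_id less_imp_le t_def)
  define j where "j = k - n"
  have "maps_cone (h ^^ j) (w n) (v j @ t)"
    using maps_cone_append[OF v[of j]] wn q_def by simp
  from maps_cone_comp[OF w this] have "maps_cone (h ^^ k) (prefix M x) (v j @ t)"
    using k(2) by (simp add: j_def flip: funpow_add)
  then have wk: "w k = v j @ t" using w maps_cone_unique by blast
  have lq: "length q = M'" by (simp add: q_def)
  have "length (v j) > M'" using k(3) wk wn lq by simp
  moreover from this have "take M' (v j) = q" using split[OF k(1)] wk by simp
  ultimately have "v j = q @ drop M' (v j)" "drop M' (v j) \<noteq> []"
    by (metis append_take_drop_id) (use \<open>length (v j) > M'\<close> in simp)
  moreover have "maps_cone (h ^^ j) q (v j)" using v q_def by simp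
  moreover have "q \<frown> t \<frown> suffix M x \<in> T" using invn[OF assms(6), of n] w_x[of n] wn by simp
  ultimately show False using scaling[of q _ j] k(2) by (metis j_def zero_less_diff)
qed

text \<open>
  A period at a point that is not hyperbolic is a period in a neighbourhood, and by compactness
  finitely many periods suffice.
\<close>
lemma hyperbolic_or_finite_order_on:
  assumes "h \<in> V" "cone_closed T"
    and inv: "\<And>x. x \<in> T \<Longrightarrow> h x \<in> T" "\<And>x. x \<in> T \<Longrightarrow> inv_fun h x \<in> T"
    and none: "T \<inter> hyperbolic_points h = {}"
  shows "\<exists>k>0. \<forall>x\<in>T. (h ^^ k) x = x"
proof (rule cone_compactness[of "\<lambda>p. \<exists>k>0. \<forall>x\<in>T. prefix (length p) x = p \<longrightarrow> (h ^^ k) x = x"])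
  fix p s assume "\<exists>k>0. \<forall>x\<in>T. prefix (length p) x = p \<longrightarrow> (h ^^ k) x = x"
  then show "\<exists>k>0. \<forall>x\<in>T. prefix (length (p @ s)) x = p @ s \<longrightarrow> (h ^^ k) x = x"
    using prefix_length_appendD by blast
next
  fix x
  show "\<exists>m. \<exists>k>0. \<forall>y\<in>T. prefix (length (prefix m x)) y = prefix m x \<longrightarrow> (h ^^ k) y = y"
  proof (cases "x \<in> T")
    case True
    then obtain n where n: "n > 0" "(h ^^ n) x = x"
      using periodic_if_no_hyperbolic_point[OF assms] by blast
    then have "log_slope (h ^^ n) x = 0" using none True by (auto simp: hyperbolic_points_def)
    then obtain m where "\<And>y. prefix m y = prefix m x \<Longrightarrow> (h ^^ n) y = y"
      using log_slope_0_imp_locally_id[OF V_funpow[OF assms(1)] n(2)] by blast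
    then show ?thesis using n(1) by auto
  next
    case False
    then obtain m where "\<And>y. y \<in> T \<Longrightarrow> prefix m y \<noteq> prefix m x"
      using assms(2) unfolding cone_closed_def by blast
    then show ?thesis by (intro exI[of _ m] exI[of _ 1]) simp
  qed
next
  fix N
  assume "\<And>p. N \<le> length p \<Longrightarrow> \<exists>k>0. \<forall>x\<in>T. prefix (length p) x = p \<longrightarrow> (h ^^ k) x = x"
  then have "\<forall>p. \<exists>k. length p = N \<longrightarrow> 0 < k \<and> (\<forall>x\<in>T. prefix N x = p \<longrightarrow> (h ^^ k) x = x)"
    by (metis order_refl)
  then obtain k where k: "\<And>p. length p = N \<Longrightarrow> 0 < k p"
    "\<And>p x. length p = N \<Longrightarrow> x \<in> T \<Longrightarrow> prefix N x = p \<Longrightarrow> (h ^^ k p) x = x"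
    by metis
  define K where "K = (\<Prod>p\<in>{p. length p = N}. k p)"
  have fin: "finite {p::bool list. length p = N}"
    using finite_lists_length_eq[of "UNIV :: bool set" N] by simp
  have "K > 0" unfolding K_def by (rule prod_pos) (use k in simp)
  moreover have "(h ^^ K) x = x" if "x \<in> T" for x
  proof -
    have "k (prefix N x) dvd K" unfolding K_def by (rule dvd_prodI[OF fin]) simp
    then obtain j where "K = k (prefix N x) * j" by (rule dvdE)
    then show ?thesis using k(2)[of "prefix N x" x] that funpow_fixed_mult by simp
  qed
  ultimately show ?thesis by blast
qed

text \<open>
  A point of the cone of \<open>u\<close> that is fixed by arbitrarily high powers of \<open>g\<close> begins with
  arbitrarily many copies of \<open>s\<close>.
\<close>
lemma periodic_points_in_scaling_cone_eq:
  assumes "maps_cone g u (u @ s)" "s \<noteq> []"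
    and "0 < j" "(g ^^ j) (u \<frown> x) = u \<frown> x" and "0 < k" "(g ^^ k) (u \<frown> y) = u \<frown> y"
  shows "x = y"
proof (rule prefixes_eq_imp_eq)
  fix m
  define i where "i = j * k * m"
  have eq: "z = concat (replicate i s) \<frown> z" if "(g ^^ i) (u \<frown> z) = u \<frown> z" for z
    using maps_coneD[OF maps_cone_funpow[OF assms(1), of i], of z] that
    by (simp flip: conc_conc)
  have "(g ^^ i) (u \<frown> x) = u \<frown> x" "(g ^^ i) (u \<frown> y) = u \<frown> y"
    using funpow_fixed_mult[OF assms(4), of "k * m"] funpow_fixed_mult[OF assms(6), of "j * m"]
    by (simp_all add: i_def mult.assoc mult.left_commute)
  then have xy: "x = concat (replicate i s) \<frown> x" "y = concat (replicate i s) \<frown> y"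
    using eq by blast+
  have "m \<le> i" using assms(3,5) by (simp add: i_def)
  then have le: "m \<le> length (concat (replicate i s))"
    using length_concat_replicate[OF assms(2)] order_trans by blast
  show "prefix m x = prefix m y"
    using xy prefix_conc_fst[OF le] by metis
qed

text \<open>
  Near a point with a prefix that all iterates replace there are no repelling periodic points,
  because their slopes grow without bound under iteration while the prefix bounds them.  At any
  other point, an iterate carries a neighbourhood into a cone that is scaled into itself, and such
  a cone contains at most one periodic point.
\<close>
lemma locally_finite_repelling_points:
  assumes "h \<in> V"
  shows "\<exists>m. finite {y. prefix m y = prefix m x \<and> (\<exists>n>0. (h ^^ n) y = y \<and> log_slope (h ^^ n) y > 0)}"
proof (cases "\<exists>M. \<forall>n. \<exists>u. maps_cone (h ^^ n) (prefix M x) u")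
  case True
  then obtain M where M: "\<And>n. \<exists>u. maps_cone (h ^^ n) (prefix M x) u" by blast
  have False if y: "prefix M y = prefix M x" "(h ^^ n) y = y" "log_slope (h ^^ n) y > 0" for y n
  proof -
    define i where "i = Suc M"
    obtain u where u: "maps_cone (h ^^ (n * i)) (prefix M y) u" using M y(1) by metis
    have "int i * log_slope (h ^^ n) y = log_slope (h ^^ (n * i)) y"
      using log_slope_funpow(2)[OF V_funpow[OF assms] y(2), of i] by (simp add: funpow_mult)
    also have "\<dots> \<le> int M" using log_slope_eq[OF u] by simp
    finally have "int i * log_slope (h ^^ n) y \<le> int M" .
    moreover have "int i * 1 \<le> int i * log_slope (h ^^ n) y"
      by (rule mult_left_mono) (use y(3) in auto)
    ultimately have "int i * 1 \<le> int M" by (rule order_trans[rotated])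
    then show False by (simp add: i_def)
  qed
  then have empty: "{y. prefix M y = prefix M x \<and>
      (\<exists>n>0. (h ^^ n) y = y \<and> log_slope (h ^^ n) y > 0)} = {}"
    by blast
  show ?thesis by (rule exI[of _ M]) (simp only: empty finite.emptyI)
next
  case False
  then have "\<And>M. \<exists>n. \<nexists>u. maps_cone (h ^^ n) (prefix M x) u" by blast
  then obtain n u y d s where u: "(h ^^ n) x = u \<frown> y" "0 < d" "s \<noteq> []"
      "maps_cone (h ^^ d) u (u @ s) \<or> maps_cone (h ^^ d) (u @ s) u"
    by (rule scaling_cone_of_unbounded_orbit[OF assms])
  obtain m where m: "\<And>y. prefix m y = prefix m x \<Longrightarrow> prefix (length u) ((h ^^ n) y) = u"
    using V_continuous[OF V_funpow[OF assms, of n], where M = 0 and x = x and l = "length u"]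
      u(1) by auto
  have "\<exists>g. maps_cone g u (u @ s) \<and> (\<forall>z k. (h ^^ k) z = z \<longrightarrow> (g ^^ k) z = z)"
    using u(4)
  proof
    assume "maps_cone (h ^^ d) u (u @ s)"
    moreover have "((h ^^ d) ^^ k) z = z" if "(h ^^ k) z = z" for z k
      using funpow_fixed_mult[OF that, of d] by (simp add: funpow_mult mult.commute)
    ultimately show ?thesis by blast
  next
    assume "maps_cone (h ^^ d) (u @ s) u"
    then have "maps_cone (inv_fun (h ^^ d)) u (u @ s)"
      using maps_cone_inv V_bij V_funpow assms by metis
    moreover have "(inv_fun (h ^^ d) ^^ k) z = z" if "(h ^^ k) z = z" for z k
    proof -
      have b: "bij (h ^^ d)" using V_bij[OF V_funpow[OF assms]] .
      have "((h ^^ d) ^^ k) z = z"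
        using funpow_fixed_mult[OF that, of d] by (simp add: funpow_mult mult.commute)
      moreover have "bij ((h ^^ d) ^^ k)" using V_bij[OF V_funpow[OF V_funpow[OF assms]]] .
      ultimately show ?thesis unfolding funpow_inv[OF b] by (metis bij_is_inj inv_f_f)
    qed
    ultimately show ?thesis by blast
  qed
  then obtain g where g: "maps_cone g u (u @ s)" "\<And>z k. (h ^^ k) z = z \<Longrightarrow> (g ^^ k) z = z"
    by blast
  let ?R = "{y. prefix m y = prefix m x \<and> (\<exists>n>0. (h ^^ n) y = y \<and> log_slope (h ^^ n) y > 0)}"
  have eq: "a = b" if jk: "0 < j" "(h ^^ j) a = a" "0 < k" "(h ^^ k) b = b"
    and ab: "prefix m a = prefix m x" "prefix m b = prefix m x" for a b j k
  proof -
    define a' b' where "a' = (h ^^ n) a" and "b' = (h ^^ n) b"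
    have "(h ^^ j) a' = a'" "(h ^^ k) b' = b'"
      unfolding a'_def b'_def using jk by (metis add.commute comp_apply funpow_add)+
    then have "(g ^^ j) a' = a'" "(g ^^ k) b' = b'" using g(2) by blast+
    moreover have split: "a' = u \<frown> suffix (length u) a'" "b' = u \<frown> suffix (length u) b'"
      using m[OF ab(1)] m[OF ab(2)] a'_def b'_def by (metis prefix_suffix)+
    ultimately have "suffix (length u) a' = suffix (length u) b'"
      using periodic_points_in_scaling_cone_eq[OF g(1) u(3) jk(1) _ jk(3)] by metis
    then have "a' = b'" using split by metis
    then show "a = b"
      using V_bij[OF V_funpow[OF assms]] unfolding a'_def b'_def by (metis bij_is_inj inj_eq)
  qed
  have "finite ?R"
  proof (cases "?R = {}")
    case False
    then obtain a where a: "a \<in> ?R" by (meson ex_in_conv)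
    have "?R \<subseteq> {a}"
    proof
      fix b assume "b \<in> ?R"
      then show "b \<in> {a}" using a eq by simp metis
    qed
    then show ?thesis by (rule finite_subset) simp
  qed (simp only: finite.emptyI)
  then show ?thesis by (rule exI)
qed

text \<open>
  The hyperbolic points are the repelling periodic points of \<open>h\<close> and of its inverse.
\<close>
lemma finite_hyperbolic_points:
  assumes "h \<in> V"
  shows "finite (hyperbolic_points h)"
proof -
  have fin: "finite {y. \<exists>n>0. (h ^^ n) y = y \<and> log_slope (h ^^ n) y > 0}" (is "finite ?R")
    if "h \<in> V" for h
  proof (rule finite_if_locally_finite[of _ "\<lambda>y. y"])
    fix x
    show "\<exists>m. finite {y \<in> ?R. prefix m y = prefix m x}"
      using locally_finite_repelling_points[OF that, of x] by (simp add: conj_commute)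
  qed
  have "hyperbolic_points h \<subseteq> {y. \<exists>n>0. (h ^^ n) y = y \<and> log_slope (h ^^ n) y > 0} \<union>
    {y. \<exists>n>0. (inv_fun h ^^ n) y = y \<and> log_slope (inv_fun h ^^ n) y > 0}"
  proof
    fix x assume "x \<in> hyperbolic_points h"
    then obtain n where n: "n > 0" "(h ^^ n) x = x" "log_slope (h ^^ n) x \<noteq> 0"
      by (auto simp: hyperbolic_points_def)
    have "(inv_fun h ^^ n) x = x" "log_slope (inv_fun h ^^ n) x = - log_slope (h ^^ n) x"
      using log_slope_inv[OF V_funpow[OF assms], of n x] n(2) funpow_inv[OF V_bij[OF assms]]
        V_bij[OF V_funpow[OF assms, of n]] by (simp_all) (metis bij_inv_eq_iff)
    then show "x \<in> {y. \<exists>n>0. (h ^^ n) y = y \<and> log_slope (h ^^ n) y > 0} \<union>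
      {y. \<exists>n>0. (inv_fun h ^^ n) y = y \<and> log_slope (inv_fun h ^^ n) y > 0}"
      using n by (cases "log_slope (h ^^ n) x > 0") auto
  qed
  then show ?thesis using fin[OF assms] fin[OF V_inv[OF assms]] finite_subset by blast
qed

lemma conjugate_funpow:
  fixes g :: "'a \<Rightarrow> 'a"
  assumes "bij g"
  shows "(g \<circ> h \<circ> inv_fun g) ^^ n = g \<circ> h ^^ n \<circ> inv_fun g"
proof
  fix x show "((g \<circ> h \<circ> inv_fun g) ^^ n) x = (g \<circ> h ^^ n \<circ> inv_fun g) x"
    using assms by (induction n) (simp_all add: bij_is_inj bij_is_surj surj_f_inv_f)
qed

lemma hyperbolic_points_conjugate:
  assumes "h \<in> V" "g \<in> V" "x \<in> hyperbolic_points h"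
  shows "g x \<in> hyperbolic_points (g \<circ> h \<circ> inv_fun g)"
proof -
  obtain n where n: "n > 0" "(h ^^ n) x = x" "log_slope (h ^^ n) x \<noteq> 0"
    using assms(3) by (auto simp: hyperbolic_points_def)
  have bij: "bij g" using V_bij[OF assms(2)] .
  have pow: "(g \<circ> h \<circ> inv_fun g) ^^ n = g \<circ> (h ^^ n) \<circ> inv_fun g" for n
    using bij by (simp add: conjugate_funpow)
  have hn: "h ^^ n \<in> V" using V_funpow[OF assms(1)] .
  have "log_slope (g \<circ> (h ^^ n) \<circ> inv_fun g) (g x)
      = log_slope (inv_fun g) (g x) + (log_slope (h ^^ n) x + log_slope g ((h ^^ n) x))"
    using log_slope_comp[OF V_inv[OF assms(2)] V_comp[OF hn assms(2)], of "g x"]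
      log_slope_comp[OF hn assms(2), of x] bij by (simp add: bij_is_inj comp_assoc)
  also have "\<dots> = log_slope (h ^^ n) x"
    using n(2) log_slope_inv[OF assms(2), of x] by simp
  finally show ?thesis
    unfolding hyperbolic_points_def using n pow bij by (auto simp: bij_is_inj intro!: exI[of _ n])
qed

section \<open>Commutators and supports\<close>

definition commutator :: "('a \<Rightarrow> 'a) \<Rightarrow> ('a \<Rightarrow> 'a) \<Rightarrow> 'a \<Rightarrow> 'a" where
  "commutator f g = f \<circ> g \<circ> inv_fun f \<circ> inv_fun g"

lemma inv_fun_apply: "bij f \<Longrightarrow> inv_fun f (f x) = x" "bij f \<Longrightarrow> f (inv_fun f y) = y"
  by (simp_all add: bij_is_inj bij_is_surj surj_f_inv_f)

lemma inv_fun_comp: "bij f \<Longrightarrow> bij g \<Longrightarrow> inv_fun (f \<circ> g) x = inv_fun g (inv_fun f x)"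
  by (simp add: o_inv_distrib)

lemma commutator_comp: "bij f \<Longrightarrow> bij g \<Longrightarrow> commutator f g \<circ> (g \<circ> f) = f \<circ> g"
  by (rule ext) (simp add: commutator_def inv_fun_apply)

text \<open>
  The two absorption rules drive the displacement arguments: a factor that commutes with
  everything else in a commutator may be dropped.
\<close>
lemma commutator_absorb_left:
  assumes "bij u" "bij u'" "bij v" "u' \<circ> v = v \<circ> u'"
  shows "commutator (u \<circ> u') v = commutator u v"
proof
  fix x
  have "u' (v y) = v (u' y)" for y using assms(4) by (metis comp_apply)
  then show "commutator (u \<circ> u') v x = commutator u v x"
    using assms by (simp add: commutator_def inv_fun_comp inv_fun_apply)
qed

lemma commutator_absorb_right:
  assumes "bij u" "bij v'" "bij v" "v' \<circ> u = u \<circ> v'"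
  shows "commutator u (v \<circ> v') = commutator u v"
proof
  fix x
  have "v' (u y) = u (v' y)" for y using assms(4) by (metis comp_apply)
  then have "v' (inv_fun u (inv_fun v' y)) = inv_fun u y" for y
    using assms(1,2) by (metis inv_fun_apply)
  then show "commutator u (v \<circ> v') x = commutator u v x"
    using assms by (simp add: commutator_def inv_fun_comp)
qed

lemma Supp_conjugate:
  assumes "bij k"
  shows "Supp (k \<circ> f \<circ> inv_fun k) = k ` Supp f"
proof (rule Set.set_eqI)
  fix x
  have "x \<in> k ` Supp f \<longleftrightarrow> inv_fun k x \<in> Supp f"
  proof
    assume "x \<in> k ` Supp f"
    then show "inv_fun k x \<in> Supp f" using inv_fun_apply(1)[OF assms] by auto
  next
    assume "inv_fun k x \<in> Supp f"
    then show "x \<in> k ` Supp f" using inv_fun_apply(2)[OF assms, of x] by (metis imageI)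
  qed
  also have "\<dots> \<longleftrightarrow> k (f (inv_fun k x)) \<noteq> k (inv_fun k x)"
    using bij_is_inj[OF assms] by (simp add: Supp_def inj_eq)
  finally show "x \<in> Supp (k \<circ> f \<circ> inv_fun k) \<longleftrightarrow> x \<in> k ` Supp f"
    using assms by (simp add: Supp_def inv_fun_apply)
qed

lemma disjoint_Supp_commute:
  assumes "bij f" "bij g" "Supp f \<inter> Supp g = {}"
  shows "f \<circ> g = g \<circ> f"
proof
  fix x
  consider "f x = x" "g x = x" | "f x \<noteq> x" "g x = x" | "f x = x" "g x \<noteq> x"
    using assms(3) by (auto simp: Supp_def)
  then show "(f \<circ> g) x = (g \<circ> f) x"
  proof cases
    case 2
    then have "f (f x) \<noteq> f x" using assms(1) by (metis inv_fun_apply(1))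
    then show ?thesis using 2 assms(3) by (auto simp: Supp_def)
  next
    case 3
    then have "g (g x) \<noteq> g x" using assms(2) by (metis inv_fun_apply(1))
    then show ?thesis using 3 assms(3) by (auto simp: Supp_def)
  qed simp
qed

lemma funpow_gt_if_strict_mono:
  fixes f :: "real \<Rightarrow> real"
  assumes "strict_mono f" "y < f x" "x \<le> y" "0 < n"
  shows "y < (f ^^ n) x"
  using assms(4)
proof (induction n rule: nat_induct_non_zero)
  case (Suc n)
  then have "x < (f ^^ n) x" using assms(3) by linarith
  then have "f x < f ((f ^^ n) x)" using assms(1) by (simp add: strict_mono_less)
  then show ?case using assms(2) by simp
qed (use assms(2) in simp)

lemma funpow_lt_if_strict_mono:
  fixes f :: "real \<Rightarrow> real"
  assumes "strict_mono f" "f x < x" "0 < n"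
  shows "(f ^^ n) x < x"
  using assms(3)
proof (induction n rule: nat_induct_non_zero)
  case (Suc n)
  then have "f ((f ^^ n) x) < f x" using assms(1) by (simp add: strict_mono_less)
  then show ?case using assms(2) by simp
qed (use assms(2) in simp)

lemma funpow_fixed_iff_if_strict_mono:
  fixes f :: "real \<Rightarrow> real"
  assumes "strict_mono f" "0 < n" "(f ^^ n) x = x"
  shows "f x = x"
  using funpow_gt_if_strict_mono[OF assms(1) _ order_refl assms(2), of x]
    funpow_lt_if_strict_mono[OF assms(1) _ assms(2), of x] assms(3) by force

text \<open>
  A finite supremum \<open>s\<close> of the orbit would be pushed up by \<open>f\<close>, so the points of the orbit just
  below \<open>s\<close> would be pushed past \<open>s\<close>.
\<close>
lemma funpow_unbounded:
  fixes f :: "real \<Rightarrow> real"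
  assumes "strict_mono f" "bij f" "\<And>x. a < x \<Longrightarrow> x < f x" "a < c"
  obtains n where "b < (f ^^ n) c"
proof (rule ccontr)
  assume "\<not> thesis"
  then have bdd: "(f ^^ n) c \<le> b" for n using that not_less by blast
  define s where "s = (SUP n. (f ^^ n) c)"
  have bdd': "bdd_above (range (\<lambda>n. (f ^^ n) c))" by (rule bdd_aboveI[of _ b]) (use bdd in auto)
  have up: "(f ^^ n) c \<le> s" for n unfolding s_def by (rule cSUP_upper[OF UNIV_I bdd'])
  have "a < s" using up[of 0] assms(4) by simp
  then have "s < f s" by (rule assms(3))
  then have "inv_fun f s < s"
    using assms(1,2) by (metis inv_fun_apply(2) strict_mono_less)
  then obtain n where "inv_fun f s < (f ^^ n) c"
    unfolding s_def using less_cSUP_iff[OF UNIV_not_empty bdd'] by blast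
  then have "s < (f ^^ Suc n) c"
    using assms(1,2) by (metis comp_apply funpow.simps(2) inv_fun_apply(2) strict_mono_less)
  then show False using up[of "Suc n"] by simp
qed

section \<open>Locally moving groups of the real line\<close>

lemma homeo_plus_simps:
  "f \<otimes>\<^bsub>homeo_plus\<^esub> g = g \<circ> f" "\<one>\<^bsub>homeo_plus\<^esub> = id"
  by (simp_all add: homeo_plus_def)

lemma homeo_plus_bij: "f \<in> carrier homeo_plus \<Longrightarrow> bij f"
  unfolding homeo_plus_def homeomorphism_def by clarsimp (metis bijI')

lemma homeo_plus_inv:
  assumes "f \<in> carrier homeo_plus"
  shows "inv\<^bsub>homeo_plus\<^esub> f = inv_fun f"
proof -
  interpret group homeo_plus by (rule group_homeo_plus)
  have "inv\<^bsub>homeo_plus\<^esub> f \<circ> f = id"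
    using r_inv[OF assms] by (simp add: homeo_plus_simps)
  then show ?thesis
    by (metis homeo_plus_bij assms bij_is_surj comp_assoc comp_id id_comp surj_iff)
qed

lemma subgroup_homeo_plus_iff:
  "subgroup H homeo_plus \<longleftrightarrow> H \<subseteq> carrier homeo_plus \<and> id \<in> H \<and>
    (\<forall>f\<in>H. \<forall>g\<in>H. f \<circ> g \<in> H) \<and> (\<forall>f\<in>H. inv_fun f \<in> H)"
  unfolding subgroup_def homeo_plus_simps using homeo_plus_inv by (auto simp: subset_iff)

lemma commutator_in_derived:
  assumes "subgroup H homeo_plus" "f \<in> H" "g \<in> H"
  shows "commutator f g \<in> derived homeo_plus H"
proof -
  have H: "inv_fun f \<in> H" "inv_fun g \<in> H" "bij f" "bij g"
    using assms unfolding subgroup_homeo_plus_iff by (auto intro: homeo_plus_bij)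
  then have "inv\<^bsub>homeo_plus\<^esub> (inv_fun f) = f" "inv\<^bsub>homeo_plus\<^esub> (inv_fun g) = g"
    using assms unfolding subgroup_homeo_plus_iff by (auto simp: homeo_plus_inv inv_inv_eq)
  then have "commutator f g = inv_fun g \<otimes>\<^bsub>homeo_plus\<^esub> inv_fun f \<otimes>\<^bsub>homeo_plus\<^esub>
      inv\<^bsub>homeo_plus\<^esub> (inv_fun g) \<otimes>\<^bsub>homeo_plus\<^esub> inv\<^bsub>homeo_plus\<^esub> (inv_fun f)"
    by (simp add: homeo_plus_simps commutator_def comp_assoc)
  then show ?thesis
    unfolding derived_def using H by (intro generate.incl) blast
qed

lemma derived_subset_if_commutators:
  assumes "subgroup H homeo_plus" "subgroup K homeo_plus"
    and "\<And>f g. f \<in> H \<Longrightarrow> g \<in> H \<Longrightarrow> commutator f g \<in> K"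
  shows "derived homeo_plus H \<subseteq> K"
  unfolding derived_def
proof (rule group.generate_subgroup_incl[OF group_homeo_plus _ assms(2)], clarsimp)
  fix f g assume fg: "f \<in> H" "g \<in> H"
  then have H: "inv_fun f \<in> H" "inv_fun g \<in> H" "bij f" "bij g"
      "inv\<^bsub>homeo_plus\<^esub> f = inv_fun f" "inv\<^bsub>homeo_plus\<^esub> g = inv_fun g"
    using assms(1) unfolding subgroup_homeo_plus_iff
    by (auto intro: homeo_plus_bij homeo_plus_inv)
  then have "f \<otimes>\<^bsub>homeo_plus\<^esub> g \<otimes>\<^bsub>homeo_plus\<^esub> inv\<^bsub>homeo_plus\<^esub> f \<otimes>\<^bsub>homeo_plus\<^esub> inv\<^bsub>homeo_plus\<^esub> g =
      commutator (inv_fun g) (inv_fun f)"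
    by (simp add: homeo_plus_simps commutator_def comp_assoc inv_inv_eq)
  then show "f \<otimes>\<^bsub>homeo_plus\<^esub> g \<otimes>\<^bsub>homeo_plus\<^esub> inv\<^bsub>homeo_plus\<^esub> f \<otimes>\<^bsub>homeo_plus\<^esub> inv\<^bsub>homeo_plus\<^esub> g \<in> K"
    using assms(3) H by simp
qed

locale locally_moving_group =
  fixes E :: "(real \<Rightarrow> real) set"
  assumes E_subgroup: "subgroup E homeo_plus"
    and E_locally_moving: "locally_moving E"
begin

lemma E_id: "id \<in> E" and E_comp: "f \<in> E \<Longrightarrow> g \<in> E \<Longrightarrow> f \<circ> g \<in> E"
  and E_inv: "f \<in> E \<Longrightarrow> inv_fun f \<in> E" and E_bij: "f \<in> E \<Longrightarrow> bij f"
  using E_subgroup homeo_plus_bij unfolding subgroup_homeo_plus_iff by (simp_all add: subset_iff)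

lemma E_strict_mono: "f \<in> E \<Longrightarrow> strict_mono f"
  using subgroup_homeo_plusD(3)[OF E_subgroup] .

lemma E_less_iff: "f \<in> E \<Longrightarrow> f x < f y \<longleftrightarrow> x < y"
  using E_strict_mono strict_mono_less by blast

lemma E_funpow: "f \<in> E \<Longrightarrow> f ^^ n \<in> E"
  by (induction n) (auto intro: E_comp E_id)

lemma E_commutator: "f \<in> E \<Longrightarrow> g \<in> E \<Longrightarrow> commutator f g \<in> E"
  unfolding commutator_def by (intro E_comp E_inv)

lemma supported_inD: "f \<in> supported_in E a b \<Longrightarrow> f \<in> E" "f \<in> supported_in E a b \<Longrightarrow> Supp f \<subseteq> {a..b}"
  by (simp_all add: supported_in_def)

lemmas supported_in_subgroup = subgroup_supported_in[OF E_subgroup]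

lemma supported_id: "id \<in> supported_in E a b"
  and supported_comp:
    "f \<in> supported_in E a b \<Longrightarrow> g \<in> supported_in E a b \<Longrightarrow> f \<circ> g \<in> supported_in E a b"
  and supported_inv: "f \<in> supported_in E a b \<Longrightarrow> inv_fun f \<in> supported_in E a b"
  using supported_in_subgroup[of a b] unfolding subgroup_homeo_plus_iff by simp_all

lemma derived_subset: "H \<subseteq> E \<Longrightarrow> derived homeo_plus H \<subseteq> E"
  using group.derived_incl[OF group_homeo_plus _ E_subgroup] .

lemma supported_conjugate:
  assumes "g \<in> supported_in E c d" "f \<in> E"
  shows "f \<circ> g \<circ> inv_fun f \<in> supported_in E (f c) (f d)"
proof -
  have "Supp (f \<circ> g \<circ> inv_fun f) = f ` Supp g"
    by (rule Supp_conjugate[OF E_bij[OF assms(2)]])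
  also have "\<dots> \<subseteq> f ` {c..d}" using supported_inD(2)[OF assms(1)] by (rule image_mono)
  also have "\<dots> \<subseteq> {f c..f d}"
    using E_strict_mono[OF assms(2)] by (auto simp: strict_mono_less_eq)
  finally show ?thesis
    using E_comp[OF E_comp[OF assms(2) supported_inD(1)[OF assms(1)]] E_inv[OF assms(2)]]
    by (simp add: supported_in_def)
qed

lemma supported_apart_commute:
  assumes "f \<in> supported_in E a b" "g \<in> supported_in E c d" "b < c"
  shows "f \<circ> g = g \<circ> f"
proof (rule disjoint_Supp_commute)
  show "Supp f \<inter> Supp g = {}"
    using supported_inD(2)[OF assms(1)] supported_inD(2)[OF assms(2)] assms(3) by fastforce
qed (use assms supported_inD E_bij in blast)+

text \<open>
  Otherwise the supremum of the orbit of \<open>x\<close> under the elements supported in \<open>[a, c]\<close> lies in the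
  open interval \<open>(a, c)\<close>, and it is a global fixed point.
\<close>
lemma displace:
  assumes "a < x" "x \<le> y" "y < c"
  obtains f where "f \<in> supported_in E a c" "y < f x"
proof (rule ccontr)
  assume "\<not> thesis"
  with that have le: "f x \<le> y" if "f \<in> supported_in E a c" for f
    using \<open>f \<in> supported_in E a c\<close> not_less by metis
  let ?O = "(\<lambda>f. f x) ` supported_in E a c"
  define s where "s = Sup ?O"
  have id: "id \<in> supported_in E a c" by (rule supported_id)
  have bdd: "bdd_above ?O" by (rule bdd_aboveI[of _ y]) (use le in auto)
  have up: "f x \<le> s" if "f \<in> supported_in E a c" for f
    unfolding s_def using that by (intro cSup_upper[OF _ bdd]) blast
  have "s \<le> y" unfolding s_def by (rule cSup_least) (use id le in auto)
  moreover have "x \<le> s" using up[OF id] by simp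
  ultimately have "s \<in> {a<..<c}" using assms by auto
  moreover have "f s = s" if f: "f \<in> supported_in E a c" for f
  proof -
    have "g s \<le> s" if g: "g \<in> supported_in E a c" for g
    proof -
      have gE: "g \<in> E" using supported_inD(1)[OF g] .
      have "h x \<le> inv_fun g s" if "h \<in> supported_in E a c" for h
      proof -
        have "g \<circ> h \<in> supported_in E a c" using g that by (rule supported_comp)
        then have "g (h x) \<le> g (inv_fun g s)" using up E_bij[OF gE] by (fastforce simp: inv_fun_apply)
        then show ?thesis using E_strict_mono[OF gE] strict_mono_less_eq by blast
      qed
      then have "s \<le> inv_fun g s" unfolding s_def using id by (intro cSup_least) auto
      then have "g s \<le> g (inv_fun g s)" using E_strict_mono[OF gE] strict_mono_less_eq by blast
      then show ?thesis using E_bij[OF gE] by (simp add: inv_fun_apply)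
    qed
    moreover have "inv_fun f \<in> supported_in E a c" using f by (rule supported_inv)
    ultimately have "f s \<le> s" "inv_fun f s \<le> s" using f by blast+
    moreover have "f (inv_fun f s) \<le> f s"
      using calculation(2) E_strict_mono supported_inD(1)[OF f] strict_mono_less_eq by blast
    ultimately show ?thesis using E_bij supported_inD(1)[OF f] by (simp add: inv_fun_apply)
  qed
  ultimately have "\<exists>x\<in>{a<..<c}. \<forall>f\<in>supported_in E a c. f x = x" by blast
  moreover have "a < c" using assms by simp
  ultimately show False using E_locally_moving unfolding locally_moving_def by simp
qed

text \<open>
  Let \<open>u\<close> and \<open>v\<close> move \<open>x\<close> to the right, where \<open>v\<close> moves nothing beyond \<open>u x\<close>.  If the two
  commuted, then \<open>v\<close> would move \<open>u x\<close> to \<open>u (v x)\<close>, which lies to the right of \<open>u x\<close> and is fixed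
  by \<open>v\<close>.
\<close>
lemma nontrivial_commutator:
  assumes "a < b"
  obtains u v where "u \<in> supported_in E a b" "v \<in> supported_in E a b" "commutator u v \<noteq> id"
proof -
  define x where "x = (a + b) / 2"
  have x: "a < x" "x < b" using assms by (auto simp: x_def)
  obtain u where u: "u \<in> supported_in E a b" "x < u x" using displace[OF x(1) order_refl x(2)] .
  obtain v where v: "v \<in> supported_in E a (min b (u x))" "x < v x"
    by (rule displace[OF x(1) order_refl, of "min b (u x)"]) (use x(2) u(2) in auto)
  have uE: "u \<in> E" and vE: "v \<in> E" using u(1) v(1) supported_inD(1) by blast+
  have "{a..min b (u x)} \<subseteq> {a..b}" by auto
  then have v': "v \<in> supported_in E a b" using v(1) by (auto simp: supported_in_def)
  have "v z = z" if "u x < z" for z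
    using supported_inD(2)[OF v(1)] that by (auto simp: Supp_def)
  then have vuvx: "v (u (v x)) = u (v x)" using E_less_iff[OF uE] v(2) by blast
  have inj: "inj u" "inj v" using E_bij uE vE bij_is_inj by blast+
  have "commutator u v \<noteq> id"
  proof
    assume "commutator u v = id"
    then have "u \<circ> v = v \<circ> u" using commutator_comp[OF E_bij[OF uE] E_bij[OF vE]] by simp
    then have uv: "u (v x) = v (u x)" by (metis comp_apply)
    then have "v (v (u x)) = v (u x)" using vuvx by simp
    then have "v (u x) = u x" using inj(2) by (simp add: inj_eq)
    then have "u (v x) = u x" using uv by simp
    then show False using inj(1) v(2) by (simp add: inj_eq)
  qed
  then show thesis using that[OF u(1) v'] by simp
qed

text \<open>
  \<open>[u, k]\<close> is \<open>u\<close> times a conjugate of its inverse whose support has been moved by \<open>k\<close> beyond that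
  of \<open>v\<close>.
\<close>
lemma commutator_displaced:
  assumes "u \<in> supported_in E a b" "v \<in> supported_in E a b" "a \<le> b" "k \<in> E" "b < k a"
  shows "commutator (commutator u k) v = commutator u v"
proof -
  have E: "u \<in> E" "v \<in> E" using assms supported_inD(1) by blast+
  define u' where "u' = k \<circ> inv_fun u \<circ> inv_fun k"
  have "inv_fun u \<in> supported_in E a b" using assms(1) by (rule supported_inv)
  then have u': "u' \<in> supported_in E (k a) (k b)"
    unfolding u'_def by (rule supported_conjugate[OF _ assms(4)])
  have "commutator u k = u \<circ> u'" by (simp add: commutator_def u'_def comp_assoc)
  moreover have "u' \<circ> v = v \<circ> u'" using supported_apart_commute[OF assms(2) u' assms(5)] by simp
  ultimately show ?thesis
    using commutator_absorb_left[of u u' v] E_bij E supported_inD(1)[OF u'] by simp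
qed

text \<open>
  If \<open>k\<close> displaces \<open>[a, b]\<close> then so does \<open>k \<circ> k\<close>, and the three intervals \<open>[a, b]\<close>, \<open>k [a, b]\<close> and
  \<open>k (k [a, b])\<close> are disjoint.  So \<open>[u, v] = [[u, k], [v, k \<circ> k]]\<close>.
\<close>
lemma commutator_as_commutator_of_derived:
  assumes "u \<in> supported_in E a b" "v \<in> supported_in E a b" "a \<le> b"
  obtains w z where "w \<in> derived homeo_plus E" "z \<in> derived homeo_plus E"
    "commutator u v = commutator w z"
proof -
  obtain k where k': "k \<in> supported_in E (a - 1) (b + 1)" "b < k a"
    by (rule displace[of "a - 1" a b "b + 1"]) (use assms(3) in auto)
  have k: "k \<in> E" "b < k a" using supported_inD(1)[OF k'(1)] k'(2) .
  have E: "u \<in> E" "v \<in> E" using assms supported_inD(1) by blast+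
  define u' where "u' = k \<circ> inv_fun u \<circ> inv_fun k"
  define v' where "v' = (k \<circ> k) \<circ> inv_fun v \<circ> inv_fun (k \<circ> k)"
  have i: "inv_fun u \<in> supported_in E a b" "inv_fun v \<in> supported_in E a b"
    using assms(1,2) supported_inv by blast+
  have u': "u' \<in> supported_in E (k a) (k b)"
    unfolding u'_def by (rule supported_conjugate[OF i(1) k(1)])
  have v': "v' \<in> supported_in E (k (k a)) (k (k b))"
    using supported_conjugate[OF i(2) E_comp[OF k(1) k(1)]] unfolding v'_def by simp
  have kk: "k b < k (k a)" using k E_less_iff by blast
  have "b < k b" using k assms(3) strict_mono_less_eq[OF E_strict_mono[OF k(1)], of a b] by simp
  have w: "commutator u k = u \<circ> u'" and z: "commutator v (k \<circ> k) = v \<circ> v'"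
    by (simp_all add: commutator_def u'_def v'_def comp_assoc)
  have "v' \<circ> u = u \<circ> v'" "v' \<circ> u' = u' \<circ> v'"
    using supported_apart_commute[OF assms(1) v'] supported_apart_commute[OF u' v' kk] kk \<open>b < k b\<close>
    by auto
  then have "v' \<circ> (u \<circ> u') = (u \<circ> u') \<circ> v'" by (metis comp_assoc)
  then have "commutator (commutator u k) (commutator v (k \<circ> k)) = commutator (commutator u k) v"
    unfolding w z using E_bij E supported_inD(1)[OF u'] supported_inD(1)[OF v']
    by (intro commutator_absorb_right bij_comp) auto
  then have "commutator u v = commutator (commutator u k) (commutator v (k \<circ> k))"
    using commutator_displaced[OF assms k] by simp
  then show thesis
    by (rule that[rotated 2])
      (intro commutator_in_derived[OF E_subgroup] E k(1) E_comp)+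
qed

end

section \<open>Locally moving groups inside Thompson's group V\<close>

lemma commutator_fixes_if_left_fixes:
  assumes "bij w" "bij v" "x \<in> P" "\<And>x. x \<in> P \<Longrightarrow> w x = x" "\<And>x. x \<in> P \<Longrightarrow> inv_fun v x \<in> P"
  shows "commutator w v x = x"
proof -
  have "inv_fun w (inv_fun v x) = inv_fun v x"
    using assms by (metis inv_fun_apply(1))
  then show ?thesis using assms by (simp add: commutator_def inv_fun_apply)
qed

lemma commutator_fixes_if_right_fixes:
  assumes "bij u" "bij k" "x \<in> P" "\<And>x. x \<in> P \<Longrightarrow> k x = x" "\<And>x. x \<in> P \<Longrightarrow> inv_fun u x \<in> P"
  shows "commutator u k x = x"
proof -
  have "inv_fun k x = x"
    using assms by (metis inv_fun_apply(1))
  then show ?thesis using assms by (simp add: commutator_def inv_fun_apply)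
qed

lemma funpow_id_on_finite_invariant_set:
  fixes f :: "'a \<Rightarrow> 'a"
  assumes "finite P" "inj f" "\<And>x. x \<in> P \<Longrightarrow> f x \<in> P"
  obtains N where "0 < N" "\<And>x. x \<in> P \<Longrightarrow> (f ^^ N) x = x"
proof -
  have "\<exists>n>0. (f ^^ n) x = x" if "x \<in> P" for x
  proof -
    have "(f ^^ n) x \<in> P" for n using that by (induction n) (simp_all add: assms(3))
    then have "finite {y. \<exists>n. y = (f ^^ n) x}"
      by (intro finite_subset[OF _ assms(1)]) blast
    then show ?thesis using funpow_inj_finite[OF assms(2)] by metis
  qed
  then obtain n where n: "\<And>x. x \<in> P \<Longrightarrow> 0 < n x \<and> (f ^^ n x) x = x" by metis
  show thesis
  proof (rule that[of "\<Prod>x\<in>P. n x"])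
    show "0 < (\<Prod>x\<in>P. n x)" using n by (intro prod_pos) blast
    fix x assume "x \<in> P"
    then obtain j where "(\<Prod>x\<in>P. n x) = n x * j"
      using dvd_prodI[OF assms(1), of x n] by (metis dvdE)
    then show "(f ^^ (\<Prod>x\<in>P. n x)) x = x"
      using n[OF \<open>x \<in> P\<close>] funpow_fixed_mult[of "n x" f x j] by simp
  qed
qed

lemma cone_closed_finite:
  assumes "finite A"
  shows "cone_closed A"
  unfolding cone_closed_def
proof (intro allI impI, rule ccontr)
  fix x assume x: "\<forall>m. \<exists>y\<in>A. prefix m y = prefix m x" "x \<notin> A"
  then have "\<forall>y\<in>A. \<exists>m. prefix m y \<noteq> prefix m x" using prefixes_eq_imp_eq by metis
  then obtain m where m: "\<And>y. y \<in> A \<Longrightarrow> prefix (m y) y \<noteq> prefix (m y) x" by metis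
  obtain y where y: "y \<in> A" "prefix (\<Sum>y\<in>A. m y) y = prefix (\<Sum>y\<in>A. m y) x" using x(1) by blast
  moreover have "m y \<le> (\<Sum>y\<in>A. m y)" using member_le_sum[OF y(1), of m] assms by simp
  ultimately show False using m prefix_eq_mono by blast
qed

locale line_group_in_V = locally_moving_group +
  fixes \<phi> :: "(real \<Rightarrow> real) \<Rightarrow> bool word \<Rightarrow> bool word"
  assumes derived_union:
      "derived homeo_plus E = (\<Union>(a, b)\<in>{(a, b). a < b}. derived homeo_plus (supported_in E a b))"
    and \<phi>_mon: "\<phi> \<in> mon (homeo_plus\<lparr>carrier := E\<rparr>) thompson_V"
begin

lemma \<phi>_V: "f \<in> E \<Longrightarrow> \<phi> f \<in> V"
  and \<phi>_comp: "f \<in> E \<Longrightarrow> g \<in> E \<Longrightarrow> \<phi> (f \<circ> g) = \<phi> f \<circ> \<phi> g"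
  and \<phi>_inj: "inj_on \<phi> E"
  using \<phi>_mon unfolding mon_def hom_def by (auto simp: homeo_plus_def thompson_V_def)

lemma \<phi>_bij: "f \<in> E \<Longrightarrow> bij (\<phi> f)"
  using \<phi>_V V_bij by blast

lemma \<phi>_id: "\<phi> id = id"
proof
  fix x
  have "\<phi> id (\<phi> id x) = \<phi> id x" using \<phi>_comp[OF E_id E_id] by (metis comp_apply comp_id)
  then show "\<phi> id x = id x" using \<phi>_bij[OF E_id] by (metis bij_is_inj id_apply inj_eq)
qed

lemma \<phi>_inv: "f \<in> E \<Longrightarrow> \<phi> (inv_fun f) = inv_fun (\<phi> f)"
proof
  fix x assume f: "f \<in> E"
  have "f \<circ> inv_fun f = id" using E_bij[OF f] by (simp add: fun_eq_iff inv_fun_apply)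
  then have "\<phi> f (\<phi> (inv_fun f) x) = x"
    using \<phi>_comp[OF f E_inv[OF f]] \<phi>_id by (metis comp_apply id_apply)
  then show "\<phi> (inv_fun f) x = inv_fun (\<phi> f) x" using inv_fun_apply(1)[OF \<phi>_bij[OF f]] by metis
qed

lemma \<phi>_funpow: "f \<in> E \<Longrightarrow> \<phi> (f ^^ n) = \<phi> f ^^ n"
proof (induction n)
  case (Suc n)
  then show ?case unfolding funpow.simps by (simp only: \<phi>_comp E_funpow)
qed (simp add: \<phi>_id flip: id_def)

lemma \<phi>_commutator: "f \<in> E \<Longrightarrow> g \<in> E \<Longrightarrow> \<phi> (commutator f g) = commutator (\<phi> f) (\<phi> g)"
  unfolding commutator_def by (simp only: \<phi>_comp \<phi>_inv E_comp E_inv)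

lemma \<phi>_slope_comp:
  "f \<in> E \<Longrightarrow> g \<in> E \<Longrightarrow> log_slope (\<phi> (f \<circ> g)) x = log_slope (\<phi> g) x + log_slope (\<phi> f) (\<phi> g x)"
  by (simp only: \<phi>_comp log_slope_comp \<phi>_V)

lemma \<phi>_slope_inv:
  "f \<in> E \<Longrightarrow> log_slope (\<phi> (inv_fun f)) (\<phi> f x) = - log_slope (\<phi> f) x"
  by (simp only: \<phi>_inv log_slope_inv \<phi>_V)

lemma subgroup_in_E:
  assumes "K \<subseteq> E" "id \<in> K" "\<And>f g. f \<in> K \<Longrightarrow> g \<in> K \<Longrightarrow> f \<circ> g \<in> K" "\<And>f. f \<in> K \<Longrightarrow> inv_fun f \<in> K"
  shows "subgroup K homeo_plus"
  using assms E_subgroup unfolding subgroup_homeo_plus_iff by blast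

lemma hyperbolic_points_conj:
  assumes "f \<in> E" "g \<in> E" "x \<in> hyperbolic_points (\<phi> g)"
  shows "\<phi> f x \<in> hyperbolic_points (\<phi> (f \<circ> g \<circ> inv_fun f))"
  using hyperbolic_points_conjugate[OF \<phi>_V[OF assms(2)] \<phi>_V[OF assms(1)] assms(3)]
  by (simp only: \<phi>_comp \<phi>_inv assms E_comp E_inv)

lemma hyperbolic_points_commuting:
  assumes "f \<in> E" "g \<in> E" "f \<circ> g = g \<circ> f" "x \<in> hyperbolic_points (\<phi> g)"
  shows "\<phi> f x \<in> hyperbolic_points (\<phi> g)"
proof -
  have "f \<circ> g \<circ> inv_fun f = g"
    unfolding assms(3) using E_bij[OF assms(1)] by (simp add: fun_eq_iff inv_fun_apply)
  then show ?thesis using hyperbolic_points_conj[OF assms(1,2,4)] by simp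
qed

lemma \<phi>_inv_fixed: "f \<in> E \<Longrightarrow> \<phi> f x = x \<Longrightarrow> \<phi> (inv_fun f) x = x"
  by (metis \<phi>_bij \<phi>_inv inv_fun_apply(1))

lemma subgroup_fixing: "subgroup {e \<in> E. \<phi> e x = x} homeo_plus"
  by (rule subgroup_in_E) (auto simp: E_id \<phi>_id E_comp \<phi>_comp E_inv \<phi>_inv_fixed)

text \<open>
  The elements supported to the left of \<open>c\<close> commute with \<open>g\<close>, hence permute the finite set \<open>P\<close> of
  hyperbolic points of \<open>\<phi> g\<close>.  One of them displaces \<open>[a, b]\<close> to the right, and so do its positive
  powers, one of which, \<open>k\<close>, is trivial on \<open>P\<close>.  Then \<open>[u, v] = [[u, k], v]\<close> is trivial on \<open>P\<close>,
  too.
\<close>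
lemma derived_fixes_hyperbolic_points:
  assumes "a < b" "b < c" "g \<in> supported_in E c d" "x \<in> hyperbolic_points (\<phi> g)"
    and "e \<in> derived homeo_plus (supported_in E a b)"
  shows "\<phi> e x = x"
proof -
  let ?P = "hyperbolic_points (\<phi> g)"
  have g: "g \<in> E" using supported_inD(1)[OF assms(3)] .
  have fin: "finite ?P" by (rule finite_hyperbolic_points[OF \<phi>_V[OF g]])
  \<comment> \<open>A gap between \<open>c'\<close> and \<open>c\<close> keeps the supports of \<open>f\<close> and \<open>g\<close> disjoint.\<close>
  define c' where "c' = (b + c) / 2"
  have c': "b < c'" "c' < c" using assms(2) by (simp_all add: c'_def)
  have inv: "\<phi> f y \<in> ?P" if "f \<in> supported_in E a' c''" "c'' < c" "y \<in> ?P" for f a' c'' y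
    using hyperbolic_points_commuting[OF supported_inD(1)[OF that(1)] g _ that(3)]
      supported_apart_commute[OF that(1) assms(3) that(2)] by blast
  obtain f where f: "f \<in> supported_in E (a - 1) c'" "b < f a"
    by (rule displace[of "a - 1" a b c']) (use assms(1) c'(1) in auto)
  have fE: "f \<in> E" using supported_inD(1)[OF f(1)] .
  obtain N where N: "0 < N" "\<And>y. y \<in> ?P \<Longrightarrow> (\<phi> f ^^ N) y = y"
    by (rule funpow_id_on_finite_invariant_set[OF fin bij_is_inj[OF \<phi>_bij[OF fE]]])
      (use inv[OF f(1) c'(2)] in auto)
  define k where "k = f ^^ N"
  have k: "k \<in> E" "b < k a" "\<And>y. y \<in> ?P \<Longrightarrow> \<phi> k y = y"
    unfolding k_def using E_funpow[OF fE]
      funpow_gt_if_strict_mono[OF E_strict_mono[OF fE] f(2) less_imp_le[OF assms(1)] N(1)] N(2)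
    by (auto simp: \<phi>_funpow[OF fE])
  have "commutator u v \<in> {e \<in> E. \<phi> e x = x}"
    if uv: "u \<in> supported_in E a b" "v \<in> supported_in E a b" for u v
  proof -
    have E: "u \<in> E" "v \<in> E" using uv supported_inD(1) by blast+
    have inv_uv: "inv_fun (\<phi> u) y \<in> ?P" "inv_fun (\<phi> v) y \<in> ?P" if "y \<in> ?P" for y
      using inv[OF supported_inv[OF uv(1)] assms(2) that] inv[OF supported_inv[OF uv(2)] assms(2) that]
      by (simp_all add: \<phi>_inv E)
    have "\<phi> (commutator u k) y = y" if "y \<in> ?P" for y
      unfolding \<phi>_commutator[OF E(1) k(1)]
      by (rule commutator_fixes_if_right_fixes[of _ _ _ ?P]) (use E k \<phi>_bij inv_uv that in auto)
    then have "\<phi> (commutator (commutator u k) v) x = x"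
      unfolding \<phi>_commutator[OF E_commutator[OF E(1) k(1)] E(2)]
      by (intro commutator_fixes_if_left_fixes[of _ _ _ ?P])
        (use E k \<phi>_bij inv_uv assms(4) E_commutator in auto)
    then show ?thesis
      using commutator_displaced[OF uv less_imp_le[OF assms(1)] k(1,2)] E E_commutator by simp
  qed
  then have "derived homeo_plus (supported_in E a b) \<subseteq> {e \<in> E. \<phi> e x = x}"
    by (rule derived_subset_if_commutators[OF supported_in_subgroup subgroup_fixing])
  then show ?thesis using assms(5) by blast
qed

abbreviation E' :: "(real \<Rightarrow> real) set" where "E' \<equiv> derived homeo_plus E"

lemma E'_subset: "E' \<subseteq> E" by (rule derived_subset) simp

lemma E'_cases:
  assumes "e \<in> E'"
  obtains a b where "a < b" "e \<in> derived homeo_plus (supported_in E a b)"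
  using assms unfolding derived_union by blast

text \<open>
  The logarithmic slope at \<open>x\<close> is a homomorphism from \<open>E'\<close> to the integers, so it vanishes on
  commutators of elements of \<open>E'\<close>, and these generate \<open>E'\<close>.
\<close>
lemma slope_0_if_derived_fixes:
  assumes fixed: "\<And>e. e \<in> E' \<Longrightarrow> \<phi> e x = x" and "e \<in> E'"
  shows "log_slope (\<phi> e) x = 0"
proof -
  let ?K = "{e \<in> E. \<phi> e x = x \<and> log_slope (\<phi> e) x = 0}"
  have K: "subgroup ?K homeo_plus"
  proof (rule subgroup_in_E)
    fix f assume f: "f \<in> ?K"
    then have "log_slope (\<phi> (inv_fun f)) x = 0" using \<phi>_slope_inv[of f x] by auto
    then show "inv_fun f \<in> ?K" using f by (simp add: E_inv \<phi>_inv_fixed)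
  next
    fix f g assume fg: "f \<in> ?K" "g \<in> ?K"
    then have "log_slope (\<phi> (f \<circ> g)) x = 0" using \<phi>_slope_comp[of f g x] by auto
    then show "f \<circ> g \<in> ?K" using fg by (simp add: E_comp \<phi>_comp)
  qed (auto simp: E_id \<phi>_id log_slope_id)
  obtain a b where ab: "a < b" "e \<in> derived homeo_plus (supported_in E a b)"
    using E'_cases[OF assms(2)] .
  have "commutator u v \<in> ?K" if uv: "u \<in> supported_in E a b" "v \<in> supported_in E a b" for u v
  proof -
    obtain w z where wz: "w \<in> E'" "z \<in> E'" "commutator u v = commutator w z"
      by (rule commutator_as_commutator_of_derived[OF uv less_imp_le[OF ab(1)]])
    have E: "w \<in> E" "z \<in> E" using wz E'_subset by auto
    have "\<phi> (commutator w z) x = x"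
      using fixed[OF commutator_in_derived[OF E_subgroup E]] .
    moreover have "log_slope (\<phi> (commutator w z \<circ> (z \<circ> w))) x = log_slope (\<phi> (w \<circ> z)) x"
      using commutator_comp[of w z] E E_bij by simp
    then have "log_slope (\<phi> (commutator w z)) x = 0"
      using E fixed[OF wz(1)] fixed[OF wz(2)] \<phi>_slope_comp[of "commutator w z" "z \<circ> w" x]
        \<phi>_slope_comp[of w z x] \<phi>_slope_comp[of z w x] \<phi>_comp[of z w]
      by (simp add: E_comp E_commutator)
    ultimately show ?thesis using wz(3) E E_commutator by simp
  qed
  then have "derived homeo_plus (supported_in E a b) \<subseteq> ?K"
    by (rule derived_subset_if_commutators[OF supported_in_subgroup K])
  then show ?thesis using ab(2) by blast
qed

section \<open>Points of Cantor space that represent infinity\<close>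

text \<open>
  The accumulation points of hyperbolic points of \<open>\<phi> g\<close>, for \<open>g \<in> E'\<close> with supports going off to
  \<open>\<infinity>\<close>.
\<close>
definition ends :: "bool word set" where
  "ends = {z. \<forall>m a. \<exists>g c d y. a < c \<and> g \<in> E' \<inter> supported_in E c d \<and>
     y \<in> hyperbolic_points (\<phi> g) \<and> prefix m y = prefix m z}"

lemma ends_closed: "cone_closed ends"
  unfolding cone_closed_def
proof (intro allI impI)
  fix x assume x: "\<forall>m. \<exists>y\<in>ends. prefix m y = prefix m x"
  show "x \<in> ends"
    unfolding ends_def
  proof (intro CollectI allI)
    fix m and a :: real
    obtain z where z: "z \<in> ends" "prefix m z = prefix m x" using x by blast
    show "\<exists>g c d y. a < c \<and> g \<in> E' \<inter> supported_in E c d \<and>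
        y \<in> hyperbolic_points (\<phi> g) \<and> prefix m y = prefix m x"
      using z(1) unfolding ends_def z(2)[symmetric] by blast
  qed
qed

text \<open>
  There are nontrivial commutators with support arbitrarily far to the right.  As homeomorphisms
  of the line they have infinite order, so their images have hyperbolic points, which accumulate
  by compactness.
\<close>
lemma ends_nonempty: "ends \<noteq> {}"
proof -
  have "\<exists>g y. g \<in> E' \<inter> supported_in E (real n + 1) (real n + 2) \<and> y \<in> hyperbolic_points (\<phi> g)" for n
  proof -
    obtain u v where uv: "u \<in> supported_in E (real n + 1) (real n + 2)"
      "v \<in> supported_in E (real n + 1) (real n + 2)" "commutator u v \<noteq> id"
      by (rule nontrivial_commutator[of "real n + 1" "real n + 2"]) auto
    define g where "g = commutator u v"
    have E: "u \<in> E" "v \<in> E" using uv supported_inD(1) by blast+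
    then have g: "g \<in> E" "g \<in> E'" "g \<in> supported_in E (real n + 1) (real n + 2)"
      unfolding g_def using commutator_in_derived[OF E_subgroup] E_commutator uv(1,2)
      by (auto simp: commutator_def intro!: supported_comp supported_inv)
    have "hyperbolic_points (\<phi> g) \<noteq> {}"
    proof
      assume "hyperbolic_points (\<phi> g) = {}"
      then obtain k where k: "k > 0" "\<And>x. (\<phi> g ^^ k) x = x"
        using hyperbolic_or_finite_order_on[OF \<phi>_V[OF g(1)], of UNIV] by (auto simp: cone_closed_def)
      then have "\<phi> (g ^^ k) = \<phi> id" using \<phi>_funpow[OF g(1)] \<phi>_id by (simp add: fun_eq_iff)
      then have "g ^^ k = id" using \<phi>_inj E_funpow[OF g(1)] E_id by (meson inj_onD)
      then have "g x = x" for x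
        using funpow_fixed_iff_if_strict_mono[OF E_strict_mono[OF g(1)] k(1), of x] by simp
      then show False using uv(3) unfolding g_def by (simp add: fun_eq_iff)
    qed
    then show ?thesis using g by blast
  qed
  then obtain g y where gy: "\<And>n. g n \<in> E' \<inter> supported_in E (real n + 1) (real n + 2)"
    "\<And>n. y n \<in> hyperbolic_points (\<phi> (g n))" by metis
  obtain z where z: "\<And>m. infinite {n. prefix m (y n) = prefix m z}"
    using accumulation_point[of y] by blast
  have "z \<in> ends"
    unfolding ends_def
  proof (intro CollectI allI)
    fix m and a :: real
    obtain n where n: "prefix m (y n) = prefix m z" "nat \<lceil>a\<rceil> \<le> n"
      using z[of m] unfolding infinite_nat_iff_unbounded_le by blast
    have "a < real n + 1" using n(2) by linarith
    then show "\<exists>g c d y. a < c \<and> g \<in> E' \<inter> supported_in E c d \<and>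
        y \<in> hyperbolic_points (\<phi> g) \<and> prefix m y = prefix m z"
      using gy[of n] n(1) by blast
  qed
  then show ?thesis by blast
qed

lemma ends_invariant:
  assumes "f \<in> E" "z \<in> ends"
  shows "\<phi> f z \<in> ends"
  unfolding ends_def
proof (intro CollectI allI)
  fix m and a :: real
  obtain k where k: "\<And>y. prefix k y = prefix k z \<Longrightarrow> prefix m (\<phi> f y) = prefix m (\<phi> f z)"
    using V_continuous[OF \<phi>_V[OF assms(1)], where M = 0 and x = z and l = m] by blast
  obtain g c d y where g: "inv_fun f a < c" "g \<in> E'" "g \<in> supported_in E c d"
      "y \<in> hyperbolic_points (\<phi> g)" "prefix k y = prefix k z"
    using assms(2) unfolding ends_def by blast
  have gE: "g \<in> E" using g(2) E'_subset by blast
  let ?h = "f \<circ> g \<circ> inv_fun f"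
  have "f (inv_fun f a) < f c" using g(1) E_less_iff[OF assms(1)] by blast
  then have "a < f c" using E_bij[OF assms(1)] by (simp add: inv_fun_apply)
  moreover have "?h \<in> E'"
  proof -
    have "?h = commutator f g \<circ> g"
      using E_bij[OF gE] by (simp add: commutator_def fun_eq_iff inv_fun_apply)
    moreover have "subgroup E' homeo_plus"
      by (rule group.derived_is_subgroup[OF group_homeo_plus])
        (use E_subgroup subgroup.subset in blast)
    ultimately show ?thesis
      using commutator_in_derived[OF E_subgroup assms(1) gE] g(2)
      unfolding subgroup_homeo_plus_iff by simp
  qed
  moreover have "?h \<in> supported_in E (f c) (f d)" by (rule supported_conjugate[OF g(3) assms(1)])
  moreover have "\<phi> f y \<in> hyperbolic_points (\<phi> ?h)"
    by (rule hyperbolic_points_conj[OF assms(1) gE g(4)])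
  ultimately show "\<exists>h c d y. a < c \<and> h \<in> E' \<inter> supported_in E c d \<and>
      y \<in> hyperbolic_points (\<phi> h) \<and> prefix m y = prefix m (\<phi> f z)"
    using k[OF g(5)] by blast
qed

text \<open>
  An element of \<open>E'\<close> fixes the hyperbolic points of \<open>\<phi> g\<close> as soon as the support of \<open>g\<close> is far
  enough to the right, so by continuity it fixes their limits.
\<close>
lemma derived_fixes_ends:
  assumes "z \<in> ends" "e \<in> E'"
  shows "\<phi> e z = z"
proof (rule prefixes_eq_imp_eq)
  fix l
  have eE: "e \<in> E" using assms(2) E'_subset by blast
  obtain a b where ab: "a < b" "e \<in> derived homeo_plus (supported_in E a b)"
    using E'_cases[OF assms(2)] .
  obtain m where m: "l \<le> m" "\<And>y. prefix m y = prefix m z \<Longrightarrow> prefix l (\<phi> e y) = prefix l (\<phi> e z)"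
    using V_continuous[OF \<phi>_V[OF eE], where M = l and x = z and l = l] by blast
  obtain g c d y where g: "b < c" "g \<in> supported_in E c d"
      "y \<in> hyperbolic_points (\<phi> g)" "prefix m y = prefix m z"
    using assms(1) unfolding ends_def by blast
  have "\<phi> e y = y" by (rule derived_fixes_hyperbolic_points[OF ab(1) g(1-3) ab(2)])
  then show "prefix l (\<phi> e z) = prefix l z"
    using m(2)[OF g(4)] prefix_eq_mono[OF g(4) m(1)] by simp
qed

lemma derived_slope_ends: "z \<in> ends \<Longrightarrow> e \<in> E' \<Longrightarrow> log_slope (\<phi> e) z = 0"
  by (rule slope_0_if_derived_fixes[OF derived_fixes_ends])

text \<open>
  Equality of germs in \<open>V\<close> at all ends.  Modulo this congruence \<open>E\<close> is abelian
  (\<open>same_at_ends_commute\<close>), which takes the place of the quotient by \<open>E'\<close>.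
\<close>
definition same_at_ends :: "(real \<Rightarrow> real) \<Rightarrow> (real \<Rightarrow> real) \<Rightarrow> bool" where
  "same_at_ends f g \<longleftrightarrow> (\<forall>z\<in>ends. \<phi> f z = \<phi> g z \<and> log_slope (\<phi> f) z = log_slope (\<phi> g) z)"

lemma same_at_ends_trans: "same_at_ends f g \<Longrightarrow> same_at_ends g h \<Longrightarrow> same_at_ends f h"
  by (simp add: same_at_ends_def)

lemma same_at_ends_comp:
  assumes "f \<in> E" "f' \<in> E" "g \<in> E" "g' \<in> E" "same_at_ends f f'" "same_at_ends g g'"
  shows "same_at_ends (f \<circ> g) (f' \<circ> g')"
  using assms ends_invariant[of g'] unfolding same_at_ends_def
  by (auto simp: \<phi>_slope_comp) (simp add: \<phi>_comp)

lemma same_at_ends_commute: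
  assumes "f \<in> E" "g \<in> E"
  shows "same_at_ends (f \<circ> g) (g \<circ> f)"
  unfolding same_at_ends_def
proof
  fix z assume z: "z \<in> ends"
  have y: "\<phi> (g \<circ> f) z \<in> ends" using ends_invariant[OF E_comp z] assms by blast
  have c: "commutator f g \<in> E'" by (rule commutator_in_derived[OF E_subgroup assms])
  have eq: "f \<circ> g = commutator f g \<circ> (g \<circ> f)"
    using commutator_comp[of f g] E_bij assms by simp
  have "\<phi> (commutator f g \<circ> (g \<circ> f)) z = \<phi> (g \<circ> f) z"
    using derived_fixes_ends[OF y c] assms by (simp add: \<phi>_comp E_comp E_commutator)
  moreover have "log_slope (\<phi> (commutator f g \<circ> (g \<circ> f))) z = log_slope (\<phi> (g \<circ> f)) z"
    using derived_slope_ends[OF y c] assms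
    by (subst \<phi>_slope_comp) (simp_all add: E_comp E_commutator)
  ultimately show "\<phi> (f \<circ> g) z = \<phi> (g \<circ> f) z \<and> log_slope (\<phi> (f \<circ> g)) z = log_slope (\<phi> (g \<circ> f)) z"
    unfolding eq[symmetric] by simp
qed

lemma same_at_ends_funpow_comp:
  assumes "f \<in> E" "g \<in> E"
  shows "same_at_ends ((f \<circ> g) ^^ n) (f ^^ n \<circ> g ^^ n)"
proof (induction n)
  case 0
  show ?case by (simp add: same_at_ends_def id_def)
next
  case (Suc n)
  have refl: "same_at_ends h h" for h by (simp add: same_at_ends_def)
  note E = assms E_funpow[OF assms(1)] E_funpow[OF assms(2)] E_funpow[OF E_comp[OF assms]]
  have "same_at_ends ((f \<circ> g) \<circ> (f \<circ> g) ^^ n) ((f \<circ> g) \<circ> (f ^^ n \<circ> g ^^ n))"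
    by (rule same_at_ends_comp[OF _ _ _ _ refl Suc]) (simp_all only: E E_comp)
  moreover have "same_at_ends (f \<circ> ((g \<circ> f ^^ n) \<circ> g ^^ n)) (f \<circ> ((f ^^ n \<circ> g) \<circ> g ^^ n))"
    by (rule same_at_ends_comp[OF _ _ _ _ refl same_at_ends_comp[OF _ _ _ _ same_at_ends_commute refl]])
      (simp_all only: E E_comp)
  ultimately show ?case
    unfolding funpow.simps by (simp only: comp_assoc) (rule same_at_ends_trans)
qed

end

section \<open>Cyclic groups of germs\<close>

lemma int_subgroup_principal:
  fixes I :: "int set"
  assumes "0 \<in> I" and diff: "\<And>i j. i \<in> I \<Longrightarrow> j \<in> I \<Longrightarrow> i - j \<in> I"
  obtains d where "d \<in> I" "\<And>i. i \<in> I \<Longrightarrow> d dvd i"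
proof (cases "I = {0}")
  case False
  have neg: "- i \<in> I" if "i \<in> I" for i using diff[OF assms(1) that] by simp
  have mult: "j * i \<in> I" if "i \<in> I" for i j
  proof -
    have *: "int n * i \<in> I" for n
    proof (induction n)
      case (Suc n)
      have "int (Suc n) * i = int n * i - (- i)" by (simp add: algebra_simps)
      then show ?case using diff[OF Suc neg[OF that]] by simp
    qed (use assms(1) in simp)
    show ?thesis using *[of "nat j"] neg[OF *[of "nat (- j)"]] by (cases "0 \<le> j") simp_all
  qed
  obtain i where i: "i \<in> I" "i \<noteq> 0" using False assms(1) by blast
  define n where "n = (LEAST n. 0 < n \<and> int n \<in> I)"
  have "\<exists>n. 0 < n \<and> int n \<in> I"
    using i neg[OF i(1)] by (intro exI[of _ "nat \<bar>i\<bar>"]) (auto simp: abs_if)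
  then have n: "0 < n \<and> int n \<in> I" unfolding n_def by (rule LeastI_ex)
  show thesis
  proof (rule that)
    fix j assume j: "j \<in> I"
    have "j mod int n = j - (j div int n) * int n" by (simp add: minus_div_mult_eq_mod)
    then have "j mod int n \<in> I" using diff[OF j mult] n by simp
    then have "\<not> 0 < nat (j mod int n)"
      using not_less_Least[of "nat (j mod int n)" "\<lambda>n. 0 < n \<and> int n \<in> I"] n
      unfolding n_def[symmetric] by (auto simp: nat_less_iff)
    moreover have "0 \<le> j mod int n" using n by simp
    ultimately have "j mod int n = 0" by linarith
    then show "int n dvd j" by (simp add: dvd_eq_mod_eq_0)
  qed (use n in simp)
qed (use that in auto)

text \<open>
  The preimage \<open>A\<close> in \<open>B\<close> of the generated subgroup has a cyclic image under \<open>\<psi>\<close>, and the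
  projection of \<open>A\<close> to the quotient factors through this image, because \<open>H\<close> contains the kernel.
\<close>
lemma (in normal) cyclic_group_generated_in_Mod:
  assumes B: "subgroup B G" and \<psi>: "\<psi> \<in> hom (G\<lparr>carrier := B\<rparr>) integer_group"
    and ker: "\<And>x. x \<in> B \<Longrightarrow> \<psi> x = 0 \<Longrightarrow> x \<in> H"
    and S: "S \<subseteq> (\<lambda>x. H #> x) ` B"
  shows "cyclic_group (subgroup_generated (G Mod H) S)"
proof -
  interpret M: group "G Mod H" by (rule factorgroup_is_group)
  interpret \<pi>: group_hom G "G Mod H" "\<lambda>x. H #> x"
    by unfold_locales (rule r_coset_hom_Mod)
  interpret B: subgroup B G by (rule B)
  interpret \<psi>: group_hom "G\<lparr>carrier := B\<rparr>" integer_group \<psi>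
    using B.subgroup_is_group[OF is_group] \<psi> by (simp add: group_hom_def group_hom_axioms_def)
  let ?X = "subgroup_generated (G Mod H) S"
  interpret X: group ?X by simp
  have Xsub: "subgroup (carrier ?X) (G Mod H)"
    unfolding carrier_subgroup_generated by (rule M.generate_is_subgroup) simp
  have X_B: "carrier ?X \<subseteq> (\<lambda>x. H #> x) ` B"
    by (rule M.subgroup_generated_minimal[OF \<pi>.subgroup_img_is_subgroup[OF B] S])
  define A where "A = {x \<in> B. H #> x \<in> carrier ?X}"
  have A: "subgroup A G"
  proof (rule subgroupI)
    show "A \<subseteq> carrier G" using B.subset by (auto simp: A_def)
    have "\<one> \<in> A" using subgroup.one_closed[OF Xsub] \<pi>.hom_one by (simp add: A_def)
    then show "A \<noteq> {}" by blast
    show "inv x \<in> A" if "x \<in> A" for x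
      using that subgroup.m_inv_closed[OF Xsub, of "H #> x"] \<pi>.hom_inv[of x] B.mem_carrier[of x]
      by (simp add: A_def)
    show "x \<otimes> y \<in> A" if "x \<in> A" "y \<in> A" for x y
      using that subgroup.m_closed[OF Xsub] by (simp add: A_def del: mult_FactGroup)
  qed
  interpret A: subgroup A G by (rule A)
  have \<psi>_mult: "\<psi> (x \<otimes> y) = \<psi> x + \<psi> y" if "x \<in> A" "y \<in> A" for x y
    using \<psi>.hom_mult[of x y] that by (simp add: A_def)
  have \<psi>_one: "\<psi> \<one> = 0" using \<psi>.hom_one by simp
  have \<psi>_inv: "\<psi> (inv x) = - \<psi> x" if "x \<in> A" for x
    using \<psi>_mult[of x "inv x"] that \<psi>_one by simp
  have pow_A: "x [^] (n::int) \<in> A" if "x \<in> A" for x n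
    by (rule subgroup_int_pow_closed[OF A that])
  have \<psi>_pow: "\<psi> (x [^] n) = n * \<psi> x" if "x \<in> A" for x and n :: int
    using \<psi>.hom_int_pow[of x n] that int_pow_consistent[OF B, of x n] by (simp add: A_def)
  obtain d where d: "d \<in> \<psi> ` A" "\<And>i. i \<in> \<psi> ` A \<Longrightarrow> d dvd i"
  proof (rule int_subgroup_principal[of "\<psi> ` A"])
    show "0 \<in> \<psi> ` A" using \<psi>_one A.one_closed by (metis imageI)
    fix i j assume "i \<in> \<psi> ` A" "j \<in> \<psi> ` A"
    then obtain x y where xy: "x \<in> A" "y \<in> A" "i = \<psi> x" "j = \<psi> y" by blast
    then have "i - j = \<psi> (x \<otimes> inv y)" using \<psi>_mult \<psi>_inv A.m_inv_closed by simp
    then show "i - j \<in> \<psi> ` A" using xy A.m_closed A.m_inv_closed by blast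
  qed blast
  then obtain x\<^sub>0 where x\<^sub>0: "x\<^sub>0 \<in> A" "d = \<psi> x\<^sub>0" by blast
  have "carrier ?X = range (\<lambda>n::int. (H #> x\<^sub>0) [^]\<^bsub>?X\<^esub> n)"
  proof
    show "range (\<lambda>n::int. (H #> x\<^sub>0) [^]\<^bsub>?X\<^esub> n) \<subseteq> carrier ?X"
      using x\<^sub>0(1) by (auto simp: A_def)
    show "carrier ?X \<subseteq> range (\<lambda>n::int. (H #> x\<^sub>0) [^]\<^bsub>?X\<^esub> n)"
    proof
      fix c assume c: "c \<in> carrier ?X"
      then obtain x where x: "x \<in> A" "c = H #> x" using X_B by (auto simp: A_def)
      then obtain n where n: "\<psi> x = n * \<psi> x\<^sub>0"
        using d(2)[of "\<psi> x"] x\<^sub>0(2) by (metis dvdE imageI mult.commute)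
      have p: "x\<^sub>0 [^] n \<in> A" by (rule pow_A[OF x\<^sub>0(1)])
      have "\<psi> (x \<otimes> inv (x\<^sub>0 [^] n)) = 0"
        using \<psi>_mult[OF x(1) A.m_inv_closed[OF p]] \<psi>_inv[OF p] \<psi>_pow[OF x\<^sub>0(1)] n by simp
      moreover have "x \<otimes> inv (x\<^sub>0 [^] n) \<in> B"
        using A.m_closed[OF x(1) A.m_inv_closed[OF p]] by (simp add: A_def)
      ultimately have "x \<otimes> inv (x\<^sub>0 [^] n) \<in> H" by (rule ker[rotated])
      then have "x \<in> H #> (x\<^sub>0 [^] n)"
        using rcos_module[OF is_group, of "x\<^sub>0 [^] n" x] p x(1) A.mem_carrier by simp
      then have "H #> (x\<^sub>0 [^] n) = H #> x"
        using repr_independence[OF _ _ is_subgroup] p A.mem_carrier by blast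
      then have "c = (H #> x\<^sub>0) [^]\<^bsub>G Mod H\<^esub> n"
        using \<pi>.hom_int_pow[of x\<^sub>0 n] x\<^sub>0(1) x(2) A.mem_carrier by simp
      also have "\<dots> = (H #> x\<^sub>0) [^]\<^bsub>?X\<^esub> n"
        using M.int_pow_subgroup_generated[of "H #> x\<^sub>0" S n] x\<^sub>0(1) by (simp add: A_def)
      finally show "c \<in> range (\<lambda>n::int. (H #> x\<^sub>0) [^]\<^bsub>?X\<^esub> n)" by blast
    qed
  qed
  moreover have "H #> x\<^sub>0 \<in> carrier ?X" using x\<^sub>0(1) by (simp add: A_def)
  ultimately show ?thesis unfolding X.cyclic_group by (rule bexI)
qed

context line_group_in_V
begin

text \<open>
  Modulo elements of \<open>E'\<close>, which are invisible at the ends, \<open>g\<close> commutes with \<open>f\<close>.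
\<close>
lemma hyperbolic_ends_invariant:
  assumes "f \<in> E" "g \<in> E" "x \<in> ends \<inter> hyperbolic_points (\<phi> f)"
  shows "\<phi> g x \<in> hyperbolic_points (\<phi> f)"
proof -
  obtain n where n: "0 < n" "(\<phi> f ^^ n) x = x" "log_slope (\<phi> f ^^ n) x \<noteq> 0"
    using assms(3) by (auto simp: hyperbolic_points_def)
  have F: "f ^^ n \<in> E" "\<phi> (f ^^ n) = \<phi> f ^^ n" using E_funpow \<phi>_funpow assms(1) by simp_all
  have same: "\<phi> (f ^^ n \<circ> g) x = \<phi> (g \<circ> f ^^ n) x"
    "log_slope (\<phi> (f ^^ n \<circ> g)) x = log_slope (\<phi> (g \<circ> f ^^ n)) x"
    using same_at_ends_commute[OF F(1) assms(2)] assms(3) unfolding same_at_ends_def by blast+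
  have "(\<phi> f ^^ n) (\<phi> g x) = \<phi> g x"
    using same(1) F n(2) assms(2) by (simp add: \<phi>_comp)
  moreover have "log_slope (\<phi> f ^^ n) (\<phi> g x) = log_slope (\<phi> f ^^ n) x"
    using same(2) F n(2) assms(2) by (simp add: \<phi>_slope_comp)
  ultimately show ?thesis using n by (auto simp: hyperbolic_points_def)
qed

text \<open>
  The set of candidates \<open>T\<close> is cut down for one element \<open>f\<close> of \<open>R\<close> at a time, and stays invariant
  under \<open>E\<close>.  If \<open>T\<close> contains hyperbolic points of \<open>\<phi> f\<close>, these form a finite invariant set,
  permuted by \<open>\<phi> f\<close>; otherwise \<open>\<phi> f\<close> has finite order on \<open>T\<close>.
\<close>
lemma common_periodic_end:
  assumes "finite R" "R \<subseteq> E"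
  obtains z k where "z \<in> ends" "0 < k" "\<And>f. f \<in> R \<Longrightarrow> (\<phi> f ^^ k) z = z"
proof -
  have "\<exists>T\<subseteq>ends. T \<noteq> {} \<and> cone_closed T \<and> (\<forall>f\<in>E. \<forall>x\<in>T. \<phi> f x \<in> T) \<and>
      (\<exists>k>0. \<forall>f\<in>R. \<forall>x\<in>T. (\<phi> f ^^ k) x = x)"
    using assms
  proof (induction R rule: finite_induct)
    case empty
    show ?case using ends_nonempty ends_closed ends_invariant by (intro exI[of _ ends]) auto
  next
    case (insert f R)
    then obtain T k where T: "T \<subseteq> ends" "T \<noteq> {}" "cone_closed T"
        "\<forall>f\<in>E. \<forall>x\<in>T. \<phi> f x \<in> T"
      and k: "k > 0" "\<forall>f\<in>R. \<forall>x\<in>T. (\<phi> f ^^ k) x = x" by auto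
    have f: "f \<in> E" using insert.prems by simp
    have "\<exists>T'\<subseteq>T. T' \<noteq> {} \<and> cone_closed T' \<and> (\<forall>f\<in>E. \<forall>x\<in>T'. \<phi> f x \<in> T') \<and>
        (\<exists>j>0. \<forall>x\<in>T'. (\<phi> f ^^ j) x = x)"
    proof (cases "T \<inter> hyperbolic_points (\<phi> f) = {}")
      case True
      have "\<exists>j>0. \<forall>x\<in>T. (\<phi> f ^^ j) x = x"
        by (rule hyperbolic_or_finite_order_on[OF \<phi>_V[OF f] T(3) _ _ True])
          (use T(4) f E_inv \<phi>_inv in \<open>metis+\<close>)
      then show ?thesis using T by blast
    next
      case False
      let ?T = "T \<inter> hyperbolic_points (\<phi> f)"
      have fin: "finite ?T" using finite_hyperbolic_points[OF \<phi>_V[OF f]] by simp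
      have inv: "\<phi> g x \<in> ?T" if "g \<in> E" "x \<in> ?T" for g x
        using T(4) hyperbolic_ends_invariant[OF f that(1)] T(1) that by blast
      obtain j where "0 < j" "\<And>x. x \<in> ?T \<Longrightarrow> (\<phi> f ^^ j) x = x"
        by (rule funpow_id_on_finite_invariant_set[OF fin bij_is_inj[OF \<phi>_bij[OF f]] inv[OF f]]) auto
      then show ?thesis using False cone_closed_finite[OF fin] inv by (intro exI[of _ ?T]) blast
    qed
    then obtain T' j where T': "T' \<subseteq> T" "T' \<noteq> {}" "cone_closed T'"
        "\<forall>f\<in>E. \<forall>x\<in>T'. \<phi> f x \<in> T'" and j: "j > 0" "\<And>x. x \<in> T' \<Longrightarrow> (\<phi> f ^^ j) x = x" by blast
    have "(\<phi> g ^^ (k * j)) x = x" if g: "g \<in> insert f R" and x: "x \<in> T'" for g x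
    proof (cases "g = f")
      case True
      then show ?thesis using funpow_fixed_mult[OF j(2)[OF x], of k] by (simp add: mult.commute)
    next
      case False
      then have "(\<phi> g ^^ k) x = x" using k(2) g x T'(1) by blast
      then show ?thesis by (rule funpow_fixed_mult)
    qed
    moreover have "k * j > 0" using k(1) j(1) by simp
    ultimately show ?case using T' T(1) by (intro exI[of _ T']) blast
  qed
  then show thesis using that by (metis ex_in_conv subsetD)
qed

text \<open>
  If not, then by tameness \<open>f\<close> or its inverse, called \<open>F\<close>, pushes a ray to \<open>\<infinity>\<close>.  Conjugation by
  powers of \<open>F\<close> carries an element \<open>g \<in> E'\<close> supported in the ray off to \<open>\<infinity>\<close>, without disturbing a
  hyperbolic point \<open>y\<close> of \<open>\<phi> g\<close> in the cone where \<open>\<phi> F\<close> is trivial.  So \<open>y\<close> is fixed by \<open>E'\<close>,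
  against hyperbolicity.
\<close>
lemma trivial_germ_at_infinity_if_near_end:
  assumes "tame_at_infinity E" "f \<in> E" "z \<in> ends"
    and near: "\<And>y. prefix m y = prefix m z \<Longrightarrow> \<phi> f y = y"
  shows "f \<in> trivial_near_infinity E"
proof (rule ccontr)
  assume nontriv: "f \<notin> trivial_near_infinity E"
  obtain a where "{a<..} \<subseteq> {x. f x = x} \<or> {a<..} \<subseteq> Supp f"
    using assms(1,2) unfolding tame_at_infinity_def by blast
  then have moves: "f x \<noteq> x" if "a < x" for x
    using nontriv assms(2) that by (auto simp: trivial_near_infinity_def Supp_def)
  obtain F where F: "F \<in> E" "\<And>x. a < x \<Longrightarrow> x < F x" "\<And>y. prefix m y = prefix m z \<Longrightarrow> \<phi> F y = y"
  proof (cases "\<forall>x>a. x < f x")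
    case True
    then show thesis using that[of f] assms(2) near by blast
  next
    case False
    then obtain w where w: "a < w" "f w < w" using moves by (metis linorder_neqE_linordered_idom)
    have down: "f x < x" if "a < x" for x
    proof (rule ccontr)
      assume "\<not> f x < x"
      then have x: "x < f x" using moves[OF that] by simp
      have cont: "continuous_on S (\<lambda>t. f t - t)" for S
        using continuous_on_subset[OF subgroup_homeo_plusD(4)[OF E_subgroup assms(2)]]
        by (intro continuous_intros) auto
      have "\<exists>t\<ge>min x w. t \<le> max x w \<and> f t - t = 0"
        using IVT'[of "\<lambda>t. f t - t" w 0 x] IVT2'[of "\<lambda>t. f t - t" w 0 x] cont x w(2)
        by (cases "x \<le> w") auto
      then show False using moves that w(1) by auto
    qed
    have "y < inv_fun f y" if "a < y" for y
    proof (rule ccontr)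
      assume le: "\<not> y < inv_fun f y"
      have fy: "f (inv_fun f y) = y" using E_bij[OF assms(2)] by (simp add: inv_fun_apply)
      have "f y < y" using down[OF that] .
      then show False using le fy E_less_iff[OF assms(2), of "inv_fun f y" y]
        by (metis not_less_iff_gr_or_eq order_less_asym)
    qed
    then show thesis
      using that[of "inv_fun f"] E_inv[OF assms(2)] near \<phi>_inv_fixed[OF assms(2)] by blast
  qed
  obtain g c d y where g: "a < c" "g \<in> E'" "g \<in> supported_in E c d"
      "y \<in> hyperbolic_points (\<phi> g)" "prefix m y = prefix m z"
    using assms(3) unfolding ends_def by blast
  have gE: "g \<in> E" using g(2) E'_subset by blast
  have "\<phi> e y = y" if e: "e \<in> E'" for e
  proof -
    obtain u v where uv: "u < v" "e \<in> derived homeo_plus (supported_in E u v)"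
      using E'_cases[OF e] .
    obtain n where n: "v < (F ^^ n) c"
      by (rule funpow_unbounded[OF E_strict_mono[OF F(1)] E_bij[OF F(1)] F(2) g(1)])
    have Fn: "F ^^ n \<in> E" by (rule E_funpow[OF F(1)])
    have "\<phi> (F ^^ n) y = y"
      unfolding \<phi>_funpow[OF F(1)] by (rule log_slope_funpow(1)[OF \<phi>_V[OF F(1)] F(3)[OF g(5)]])
    then have "y \<in> hyperbolic_points (\<phi> (F ^^ n \<circ> g \<circ> inv_fun (F ^^ n)))"
      using hyperbolic_points_conj[OF Fn gE g(4)] by simp
    then show ?thesis
      by (rule derived_fixes_hyperbolic_points[OF uv(1) n supported_conjugate[OF g(3) Fn] _ uv(2)])
  qed
  then have "\<phi> g y = y" "log_slope (\<phi> g) y = 0"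
    using g(2) slope_0_if_derived_fixes by blast+
  then have "log_slope (\<phi> g ^^ n) y = 0" for n
    using log_slope_funpow(2)[OF \<phi>_V[OF gE]] by simp
  then show False using g(4) by (simp add: hyperbolic_points_def)
qed

lemma trivial_near_infinity_root:
  assumes "tame_at_infinity E" "f \<in> E" "0 < k" "f ^^ k \<in> trivial_near_infinity E"
  shows "f \<in> trivial_near_infinity E"
proof -
  obtain a where "\<And>x. a < x \<Longrightarrow> (f ^^ k) x = x"
    using assms(4) by (auto simp: trivial_near_infinity_def)
  then have "\<And>x. a < x \<Longrightarrow> f x = x"
    using funpow_fixed_iff_if_strict_mono[OF E_strict_mono[OF assms(2)] assms(3)] by blast
  then show ?thesis using assms(2) by (auto simp: trivial_near_infinity_def)
qed

text \<open>
  On the group \<open>B\<close> of all \<open>f\<close> whose \<open>k\<close>-th power fixes the end \<open>z\<close>, the slope at \<open>z\<close> of the \<open>k\<close>-th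
  power is additive, since \<open>E\<close> is abelian at the ends.  Slope zero makes the \<open>k\<close>-th power trivial
  near \<open>z\<close>, hence near \<open>\<infinity>\<close>, and a strictly increasing map fixes every point that one of its
  positive powers fixes.
\<close>
lemma finitely_generated_germs_cyclic:
  assumes tame: "tame_at_infinity E"
    and "finite S" "S \<subseteq> carrier (germs_at_infinity E)"
  shows "cyclic_group (subgroup_generated (germs_at_infinity E) S)"
proof -
  let ?G = "homeo_plus\<lparr>carrier := E\<rparr>" and ?N = "trivial_near_infinity E"
  interpret N: normal ?N ?G by (rule trivial_near_infinity_normal[OF E_subgroup])
  have "S \<subseteq> (\<lambda>f. ?N #>\<^bsub>?G\<^esub> f) ` E"
    using assms(3) unfolding germs_at_infinity_def carrier_FactGroup by simp
  from finite_subset_image[OF assms(2) this]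
  obtain R where R: "finite R" "R \<subseteq> E" "S = (\<lambda>f. ?N #>\<^bsub>?G\<^esub> f) ` R" by auto
  obtain z k where z: "z \<in> ends" "0 < k" "\<And>f. f \<in> R \<Longrightarrow> (\<phi> f ^^ k) z = z"
    using common_periodic_end[OF R(1,2)] by blast
  define B where "B = {f \<in> E. \<phi> (f ^^ k) z = z}"
  define \<psi> where "\<psi> f = log_slope (\<phi> (f ^^ k)) z" for f
  have comp: "f \<circ> g \<in> B \<and> \<psi> (f \<circ> g) = \<psi> f + \<psi> g" if "f \<in> B" "g \<in> B" for f g
  proof -
    have E: "f \<in> E" "g \<in> E" "f ^^ k \<in> E" "g ^^ k \<in> E" using that E_funpow by (auto simp: B_def)
    have "\<phi> ((f \<circ> g) ^^ k) z = \<phi> (f ^^ k \<circ> g ^^ k) z \<and>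
        log_slope (\<phi> ((f \<circ> g) ^^ k)) z = log_slope (\<phi> (f ^^ k \<circ> g ^^ k)) z"
      using same_at_ends_funpow_comp[OF E(1,2), of k] z(1) unfolding same_at_ends_def by blast
    then show ?thesis
      using that E by (simp add: B_def \<psi>_def \<phi>_slope_comp E_comp) (simp add: \<phi>_comp)
  qed
  have inv: "inv_fun f \<in> B" if "f \<in> B" for f
  proof -
    have f: "f \<in> E" "\<phi> (f ^^ k) z = z" using that by (simp_all add: B_def)
    then have "\<phi> (inv_fun f ^^ k) z = z"
      using \<phi>_inv_fixed[OF E_funpow[OF f(1)], of k z] funpow_inv[OF E_bij[OF f(1)], of k] by simp
    then show ?thesis using E_inv[OF f(1)] by (simp add: B_def)
  qed
  have "subgroup B homeo_plus"
    using comp inv by (intro subgroup_in_E) (auto simp: B_def E_id \<phi>_id)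
  then have B: "subgroup B ?G"
    by (rule group.subgroup_incl[OF group_homeo_plus _ E_subgroup]) (auto simp: B_def)
  have "\<psi> \<in> hom (?G\<lparr>carrier := B\<rparr>) integer_group"
    using comp by (auto simp: hom_def homeo_plus_def)
  moreover have "f \<in> ?N" if fB: "f \<in> B" "\<psi> f = 0" for f
  proof -
    have f: "f \<in> E" "f ^^ k \<in> E" "\<phi> (f ^^ k) z = z" using fB(1) E_funpow by (auto simp: B_def)
    obtain m where "\<And>y. prefix m y = prefix m z \<Longrightarrow> \<phi> (f ^^ k) y = y"
      using log_slope_0_imp_locally_id[OF \<phi>_V[OF f(2)] f(3)] fB(2) unfolding \<psi>_def by blast
    then have "f ^^ k \<in> ?N"
      by (rule trivial_germ_at_infinity_if_near_end[OF tame f(2) z(1)])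
    then show ?thesis by (rule trivial_near_infinity_root[OF tame f(1) z(2)])
  qed
  moreover have "S \<subseteq> (\<lambda>f. ?N #>\<^bsub>?G\<^esub> f) ` B"
    using R z(3) \<phi>_funpow by (auto simp: B_def)
  ultimately show ?thesis
    unfolding germs_at_infinity_def by (intro N.cyclic_group_generated_in_Mod[OF B]) auto
qed

end

theorem theoremC:
  fixes E :: "(real \<Rightarrow> real) set"
  assumes "subgroup E homeo_plus"
    and "robust E"
    and "fg_filtered E"
    and "tame_at_infinity E"
    and "\<exists>\<phi>. \<phi> \<in> mon (homeo_plus\<lparr>carrier := E\<rparr>) thompson_V"
  shows "\<forall>S. finite S \<longrightarrow> S \<subseteq> carrier (germs_at_infinity E) \<longrightarrow>
           cyclic_group (subgroup_generated (germs_at_infinity E) S)"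
proof -
  obtain \<phi> where "\<phi> \<in> mon (homeo_plus\<lparr>carrier := E\<rparr>) thompson_V" using assms(5) by blast
  then interpret line_group_in_V E \<phi>
    using assms(1,2)
    by (intro line_group_in_V.intro locally_moving_group.intro line_group_in_V_axioms.intro)
      (simp_all add: robust_def)
  show ?thesis using finitely_generated_germs_cyclic[OF assms(4)] by blast
qed

end
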